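(* Let $p$ be an odd prime, let $f=\exp(x^p/p+x)$, and let $$\Delta_3=\left[\left(\mathcal{D}\frac{1}{x}\right)^3 f\right]_0-\frac{1}{3!}\left(\left[\left(\mathcal{D}\frac{1}{x}\right) f\right]_0\right)^3 .$$ Then $$\Delta_3=\frac{L_p(3,\omega^{-2})}{3}.$$
   Context: $p$ is an odd prime and $\mathbb{C}_p$ is the completion of the algebraic closure of $\mathbb{Q}_p$. The power series $f=\exp(x^p/p+x)=\sum_{i\ge 0}B_i x^i$ (Dwork exponential) has coefficients $B_i\in\mathbb{Q}$. $\mathcal{D}=\sum_{i=0}^\infty \partial_x^i$ is a formal differential operator of infinite order. The operator $\mathcal{D}\frac1x$ means: multiply by $1/x$, then apply $\mathcal{D}$; $\left(\mathcal{D}\frac1x\right)^s$ is its $s$-fold iterate. On a monomial $x^k$ ($k\ge 0$) the result is a formal Laurent series, with only finitely many positive powers of $x$ but possibly infinitely many negative powers. $[\,\cdot\,]_0$ denotes the coefficient of $x^0$ of a formal Laurent series. For a power series $g=\sum_i a_i x^i$ over $\mathbb{C}_p$ the quantity is computed termwise, $\left[\left(\mathcal{D}\frac1x\right)^s g\right]_0=\sum_i a_i\left[\left(\mathcal{D}\frac1x\right)^s x^i\right]_0$, as a $p$-adic infinite sum. $L_p$ is the Kubota-Leopoldt $p$-adic $L$-function and $\omega$ is the Teichmüller character. For integers $s\ge 2$ the value used is $$L_p(s,\omega^{1-s})=\frac{1}{s-1}\lim_{k\to\infty}\frac{1}{p^{k+1}}\sum_{1\le n\le p^{k+1},\ p\nmid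 n}\frac{1}{n^{s-1}},$$ the limit being taken $p$-adically. *)

theory Defs
  imports "HOL-Analysis.Analysis" "HOL-Computational_Algebra.Computational_Algebra"
begin

text \<open>
  The library reserves \<open>norm\<close> for real vector spaces, which excludes \<open>p\<close>-adic fields.
  Nonnegativity and definiteness of \<open>absval\<close> are inherited from the metric.
\<close>

class nonarch_field = field_char_0 + metric_space +
  fixes absval :: "'a \<Rightarrow> real"
  assumes dist_absval: "dist x y = absval (x - y)"
    and absval_mult: "absval (x * y) = absval x * absval y"
    and absval_add: "absval (x + y) \<le> max (absval x) (absval y)"

text \<open>
  \<open>\<rat>\<^sub>p\<close> inside a complete field whose absolute value satisfies \<open>absval p = 1/p\<close>: the
  completion of \<open>\<rat>\<close> is then the topological closure of the prime field, and \<open>absval\<close>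
  restricts to the usual \<open>p\<close>-adic absolute value on \<open>\<rat>\<close>.
\<close>

definition padic_rationals :: "'a::nonarch_field set" where
  "padic_rationals = closure (range of_rat)"

definition padic_algebraic :: "'a::nonarch_field set" where
  "padic_algebraic =
     {x. \<exists>q. q \<noteq> 0 \<and> (\<forall>i. coeff q i \<in> padic_rationals) \<and> poly q x = 0}"

text \<open>
  The field \<open>\<complex>\<^sub>p\<close>, i.e. the completion of an algebraic closure of \<open>\<rat>\<^sub>p\<close>, as a
  property of a type. It determines the field up to isometric isomorphism:
  the elements algebraic over \<open>\<rat>\<^sub>p\<close> form an algebraically closed field, they are dense,
  and the whole type is complete.
\<close>

definition is_padic_complex :: "nat \<Rightarrow> 'a::{nonarch_field, complete_space} itself \<Rightarrow> bool" where
  "is_padic_complex p _ \<longleftrightarrow>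
     absval (of_nat p :: 'a) = 1 / real p \<and>
     (\<forall>q :: 'a poly. (\<forall>i. coeff q i \<in> padic_algebraic) \<and> degree q > 0 \<longrightarrow>
        (\<exists>x \<in> padic_algebraic. poly q x = 0)) \<and>
     closure (padic_algebraic :: 'a set) = UNIV"

definition dwork_exp :: "nat \<Rightarrow> 'a::field_char_0 fps" where
  "dwork_exp p = fps_compose (fps_exp 1) (fps_const (1 / of_nat p) * fps_X ^ p + fps_X)"

text \<open>
  A formal Laurent series \<open>\<Sum>n. g n * x^n\<close> is represented by its coefficient function on
  \<open>int\<close>. The library type \<open>fls\<close> allows only finitely many negative exponents, whereas here
  there are finitely many positive and possibly infinitely many negative ones.
\<close>

definition laurent_deriv :: "(int \<Rightarrow> 'a::comm_ring_1) \<Rightarrow> int \<Rightarrow> 'a" where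
  "laurent_deriv g = (\<lambda>n. of_int (n + 1) * g (n + 1))"

definition laurent_div_x :: "(int \<Rightarrow> 'a) \<Rightarrow> int \<Rightarrow> 'a" where
  "laurent_div_x g = (\<lambda>n. g (n + 1))"

definition laurent_monom :: "nat \<Rightarrow> int \<Rightarrow> 'a::comm_ring_1" where
  "laurent_monom k = (\<lambda>n. if n = int k then 1 else 0)"

text \<open>
  \<open>\<D> = \<Sum>i. \<partial>^i\<close>, coefficientwise. If \<open>g\<close> has finitely many positive exponents, then for
  each \<open>n\<close> only finitely many \<open>i\<close> contribute; the sum below runs over these.
\<close>

definition diff_op_D :: "(int \<Rightarrow> 'a::comm_ring_1) \<Rightarrow> int \<Rightarrow> 'a" where
  "diff_op_D g = (\<lambda>n. \<Sum>i | (laurent_deriv ^^ i) g n \<noteq> 0. (laurent_deriv ^^ i) g n)"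

definition D_inv_x_monom_coeff0 :: "nat \<Rightarrow> nat \<Rightarrow> 'a::comm_ring_1" where
  "D_inv_x_monom_coeff0 s k = ((diff_op_D \<circ> laurent_div_x) ^^ s) (laurent_monom k) 0"

definition D_inv_x_terms :: "nat \<Rightarrow> 'a::comm_ring_1 fps \<Rightarrow> nat \<Rightarrow> 'a" where
  "D_inv_x_terms s g i = fps_nth g i * D_inv_x_monom_coeff0 s i"

definition D_inv_x_coeff0 :: "nat \<Rightarrow> 'a::nonarch_field fps \<Rightarrow> 'a" where
  "D_inv_x_coeff0 s g = (\<Sum>i. D_inv_x_terms s g i)"

text \<open>
  For an integer \<open>s \<ge> 2\<close>, \<open>kubota_leopoldt_L p s\<close> is the value of the Kubota-Leopoldt
  \<open>p\<close>-adic \<open>L\<close>-function \<open>L\<^sub>p(s, \<omega>^(1 - s))\<close>, \<open>\<omega>\<close> the Teichmueller character, given by its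
  \<open>p\<close>-adic (Volkenborn) limit formula.
\<close>

definition kubota_leopoldt_seq :: "nat \<Rightarrow> nat \<Rightarrow> nat \<Rightarrow> 'a::field_char_0" where
  "kubota_leopoldt_seq p s k =
     1 / of_nat (p ^ (k + 1)) *
     (\<Sum>n \<in> {n. 1 \<le> n \<and> n \<le> p ^ (k + 1) \<and> \<not> p dvd n}. 1 / of_nat n ^ (s - 1))"

definition kubota_leopoldt_L :: "nat \<Rightarrow> nat \<Rightarrow> 'a::nonarch_field" where
  "kubota_leopoldt_L p s = 1 / (of_nat s - 1) * lim (kubota_leopoldt_seq p s)"

end

theory Submission
  imports Defs "HOL-Combinatorics.Stirling" "HOL-Number_Theory.Residues"
begin

text \<open>
  On monomials \<open>[(D 1/x)\<^sup>s x\<^sup>k]\<^sub>0\<close> is the unsigned Stirling number of the first kind, so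
  \<open>g\<^sub>s = [(D 1/x)\<^sup>s f]\<^sub>0\<close> is the coefficient of \<open>t\<^sup>s\<close> in
  \<open>G(t) = \<Sum>k. B\<^sub>k t(t+1)\<dots>(t+k-1)\<close>. Since \<open>exp(x) f(-x) = exp(-x^p/p)\<close>,
  \<open>G(-n)\<close> is, for \<open>p\<close> dividing \<open>n\<close>, up to sign the product of the integers up to \<open>n\<close> prime to \<open>p\<close>
  (so near \<open>0\<close>, \<open>G(t)\<close> is the \<open>p\<close>-adic Gamma function at \<open>-t\<close>). With \<open>N = p^(k+1)\<close> and \<open>j\<close> running over the
  integers up to \<open>N\<close> prime to \<open>p\<close>, this gives \<open>G(-2N) = G(-N)\<^sup>2 \<Prod>j. (1 + N/j)\<close>, and pairing \<open>j\<close> with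
  \<open>N - j\<close> shows that the square of the product is \<open>1 - 2N\<^sup>2 (\<Sum>j. 1/j\<^sup>2) + O(N\<^sup>4)\<close>. Comparing
  expansions up to \<open>O(N\<^sup>4)\<close> yields \<open>g\<^sub>2 = g\<^sub>1\<^sup>2/2\<close> and \<open>(\<Sum>j. 1/j\<^sup>2)/N \<rightarrow> 6 g\<^sub>3 - g\<^sub>1\<^sup>3\<close>.
\<close>

section \<open>The operator and Stirling numbers\<close>

lemma laurent_deriv_funpow:
  "(laurent_deriv ^^ i) g n = pochhammer (of_int (n + 1)) i * g (n + int i)"
  by (induction i arbitrary: n)
     (simp_all add: laurent_deriv_def pochhammer_rec algebra_simps)

text \<open>Only exponents at least \<open>n\<close> feed into the coefficient at \<open>n\<close>,
  so for \<open>n \<ge> 0\<close> the range \<open>i \<le> K\<close> catches every nonzero term. The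
  infinite tail of negative exponents never enters.\<close>

lemma diff_op_D_eq:
  assumes "\<And>m. m > int K \<Longrightarrow> g m = 0" and "n \<ge> 0"
  shows "diff_op_D g n = (\<Sum>i\<le>K. pochhammer (of_int (n + 1)) i * g (n + int i))"
  unfolding diff_op_D_def
proof (rule sum.mono_neutral_cong_left)
  show "{i. (laurent_deriv ^^ i) g n \<noteq> 0} \<subseteq> {..K}"
  proof
    fix i assume "i \<in> {i. (laurent_deriv ^^ i) g n \<noteq> 0}"
    then have "\<not> n + int i > int K" using assms(1) by (force simp: laurent_deriv_funpow)
    then show "i \<in> {..K}" using assms(2) by simp
  qed
qed (auto simp: laurent_deriv_funpow)

lemma diff_op_D_vanish:
  assumes "\<And>m. m > int K \<Longrightarrow> g m = 0" and "n > int K"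
  shows "diff_op_D g n = 0"
  using assms by (subst diff_op_D_eq[of K]) auto

text \<open>\<open>pochhammer (Suc j) (k - 1 - j)\<close> is (k-1)!/j!, the coefficient of x^j in
  D(1/x) x^k. Passing from \<open>k\<close> to \<open>Suc k\<close> multiplies the old terms by
  \<open>k\<close> and adds the term \<open>j = k\<close>: this is the Stirling recurrence.\<close>

lemma fact_stirling_sum:
  "(\<Sum>j<k. pochhammer (Suc j) (k - 1 - j) * stirling j s) = stirling k (Suc s)"
proof (induction k)
  case (Suc k)
  have "(\<Sum>j<k. pochhammer (Suc j) (k - j) * stirling j s)
      = (\<Sum>j<k. k * (pochhammer (Suc j) (k - 1 - j) * stirling j s))"
  proof (rule sum.cong)
    fix j assume "j \<in> {..<k}"
    then have "k - j = Suc (k - 1 - j)" "Suc j + (k - 1 - j) = k" by auto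
    then show "pochhammer (Suc j) (k - j) * stirling j s
        = k * (pochhammer (Suc j) (k - 1 - j) * stirling j s)"
      by (simp add: pochhammer_Suc algebra_simps)
  qed simp
  then show ?case using Suc by (simp flip: sum_distrib_left)
qed simp

text \<open>General \<open>g\<close> is needed because one application already turns a monomial into
  a whole series. The innermost application is peeled off as \<open>h\<close>, the induction
  hypothesis is applied to \<open>h\<close>, and \<open>fact_stirling_sum\<close> adds up its
  coefficients.\<close>

lemma iterate_coeff0_stirling:
  fixes g :: "int \<Rightarrow> 'a::comm_ring_1"
  assumes "\<And>n. n > int K \<Longrightarrow> g n = 0"
  shows "((diff_op_D \<circ> laurent_div_x) ^^ s) g 0 = (\<Sum>k\<le>K. of_nat (stirling k s) * g (int k))"
  using assms
proof (induction s arbitrary: g)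
  case 0
  have "(\<Sum>k\<le>K. of_nat (stirling k 0) * g (int k)) = (\<Sum>k\<in>{0}. of_nat (stirling k 0) * g (int k))"
    by (rule sum.mono_neutral_right) auto
  then show ?case by simp
next
  case (Suc s)
  define h where "h = diff_op_D (laurent_div_x g)"
  have v: "laurent_div_x g n = 0" if "n > int K" for n
    using Suc.prems that by (simp add: laurent_div_x_def)
  have h: "h (int j) = (\<Sum>k\<in>{j<..K}. of_nat (pochhammer (Suc j) (k - 1 - j)) * g (int k))" for j
  proof -
    have "h (int j) = (\<Sum>i\<le>K. of_nat (pochhammer (Suc j) i) * g (int (Suc (j + i))))"
      unfolding h_def by (subst diff_op_D_eq[OF v])
        (auto simp: laurent_div_x_def pochhammer_of_nat[symmetric] ac_simps intro!: sum.cong)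
    also have "\<dots> = (\<Sum>i\<in>{i. Suc (j + i) \<le> K}. of_nat (pochhammer (Suc j) i) * g (int (Suc (j + i))))"
      using Suc.prems by (intro sum.mono_neutral_right) auto
    also have "\<dots> = (\<Sum>k\<in>{j<..K}. of_nat (pochhammer (Suc j) (k - 1 - j)) * g (int k))"
      by (rule sum.reindex_bij_witness[of _ "\<lambda>k. k - 1 - j" "\<lambda>i. Suc (j + i)"]) auto
    finally show ?thesis .
  qed
  have "((diff_op_D \<circ> laurent_div_x) ^^ Suc s) g 0 = ((diff_op_D \<circ> laurent_div_x) ^^ s) h 0"
    by (simp add: funpow_Suc_right h_def del: funpow.simps)
  also have "\<dots> = (\<Sum>j\<le>K. of_nat (stirling j s) * h (int j))"
    by (rule Suc.IH) (simp add: h_def diff_op_D_vanish[OF v])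
  also have "\<dots> = (\<Sum>j\<le>K. \<Sum>k\<in>{j<..K}.
      of_nat (pochhammer (Suc j) (k - 1 - j) * stirling j s) * g (int k))"
    by (simp add: h sum_distrib_left mult_ac)
  also have "\<dots> = (\<Sum>k\<le>K. \<Sum>j<k.
      of_nat (pochhammer (Suc j) (k - 1 - j) * stirling j s) * g (int k))"
    by (subst (1 2) sum.Sigma, simp, simp, simp, simp)
       (rule sum.reindex_bij_witness[of _ prod.swap prod.swap], auto)
  also have "\<dots> = (\<Sum>k\<le>K. of_nat (stirling k (Suc s)) * g (int k))"
    unfolding fact_stirling_sum[symmetric] of_nat_sum sum_distrib_right ..
  finally show ?case .
qed

lemma D_inv_x_monom_coeff0_stirling: "D_inv_x_monom_coeff0 s k = of_nat (stirling k s)"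
proof -
  have "D_inv_x_monom_coeff0 s k = (\<Sum>j\<le>k. of_nat (stirling j s) * laurent_monom k (int j) :: 'a)"
    unfolding D_inv_x_monom_coeff0_def
    by (rule iterate_coeff0_stirling) (simp add: laurent_monom_def)
  then show ?thesis by (simp add: laurent_monom_def if_distrib sum.delta cong: if_cong)
qed

text \<open>\<open>p ^ s * stirling (Suc k) s\<close> is the coefficient of t^s in the product of
  \<open>p * t + j\<close> over \<open>j \<le> k\<close>, and \<open>k div p + 1\<close> of these
  factors are divisible by \<open>p\<close>. The induction adds one factor at a time.\<close>

lemma power_dvd_stirling_Suc: "p ^ Suc (k div p) dvd p ^ s * stirling (Suc k) s"
proof (induction k arbitrary: s)
  case 0
  then show ?case by (cases s) simp_all
next
  case (Suc k)
  show ?case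
  proof (cases s)
    case (Suc t)
    have *: "p ^ s * stirling (Suc (Suc k)) s
        = Suc k * (p ^ s * stirling (Suc k) s) + p * (p ^ t * stirling (Suc k) t)"
      by (simp add: Suc algebra_simps)
    show ?thesis
    proof (cases "p dvd Suc k")
      case True
      then have "Suc k div p = Suc (k div p)" by (simp add: div_Suc)
      then show ?thesis unfolding *
        using mult_dvd_mono[OF True Suc.IH[of s]] mult_dvd_mono[OF dvd_refl[of p] Suc.IH[of t]]
        by (metis dvd_add power_Suc)
    next
      case False
      then have "Suc k div p = k div p" by (simp add: div_Suc dvd_eq_mod_eq_0)
      then show ?thesis unfolding * using Suc.IH[of s] Suc.IH[of t]
        by (metis dvd_add dvd_mult)
    qed
  qed simp
qed

lemma power_dvd_stirling: "p ^ (k div p) dvd p ^ s * stirling k s"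
proof (cases k)
  case (Suc n)
  have "p ^ (k div p) dvd p ^ Suc (n div p)"
    by (rule le_imp_power_dvd) (simp add: Suc div_Suc)
  then show ?thesis using power_dvd_stirling_Suc[of p n s] Suc dvd_trans by blast
qed simp

section \<open>Divisibility of the coefficients of the Dwork exponential\<close>

text \<open>The integers \<open>k! B\<^sub>k\<close>; the recursion is \<open>f' = (1 + x^(p-1)) f\<close>.\<close>

fun dwork_num :: "nat \<Rightarrow> nat \<Rightarrow> int" where
  "dwork_num p 0 = 1"
| "dwork_num p (Suc k) = dwork_num p k +
     (if p \<le> Suc k then pochhammer (int (Suc (Suc k) - p)) (p - 1) * dwork_num p (k - (p - 1)) else 0)"

text \<open>The state of an induction over blocks of \<open>p\<close> indices: \<open>b\<close>
  serves the block starting at \<open>p * (m - 1)\<close>, \<open>c\<close> the first entry of the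
  next block, which can be better divisible and from which that block grows.\<close>

definition block_dvd :: "nat \<Rightarrow> nat \<Rightarrow> nat \<Rightarrow> nat \<Rightarrow> bool" where
  "block_dvd p m b c \<longleftrightarrow> 0 < m \<and>
     (\<forall>r<p. int p ^ b dvd dwork_num p (p * (m - 1) + r)) \<and> int p ^ c dvd dwork_num p (p * m)"

lemma dwork_num_small: "k < p \<Longrightarrow> dwork_num p k = 1"
  by (induction k) auto

lemma pochhammer_int_fact_cong: "[pochhammer (int p * m + 1) r = fact r] (mod int p)"
proof (induction r)
  case (Suc r)
  have "[int p * m + 1 + int r = 0 + 1 + int r] (mod int p)"
    by (intro cong_add cong_refl) (simp add: cong_def)
  from cong_mult[OF this Suc] show ?case
    by (simp add: pochhammer_Suc ac_simps)
qed simp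

lemma dvd_pochhammer_int:
  assumes "a \<le> x" "x < a + int n"
  shows "x dvd pochhammer a n"
proof -
  have "a + int (nat (x - a)) dvd (\<Prod>i = 0..<n. a + int i)"
    using assms by (intro dvd_prodI) auto
  then show ?thesis using assms by (simp add: pochhammer_prod)
qed

text \<open>
  By Wilson's theorem one factor \<open>p\<close> is gained in every second block of \<open>p\<close> consecutive indices, and
  a further one when \<open>p\<close> divides \<open>m\<close>: altogether \<open>(p + 1)/2\<close> factors per \<open>p\<^sup>2\<close> indices. For all odd \<open>p\<close>
  this suffices for convergence, although for \<open>p = 3\<close> the gain without the further factor would not.
\<close>

context
  fixes p :: nat
  assumes p: "prime p" "odd p"
begin

lemma p_ge_3: "p \<ge> 3"
  using p prime_ge_2_nat[of p] by (cases "p = 2") auto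

text \<open>Inside the block at \<open>p * m\<close>, successive numerators differ by an entry of
  the previous block times a product containing the factor \<open>p * m\<close>, which gains
  \<open>1 + d\<close>. On entering the next block the product consists of units only, and Wilson's
  theorem supplies the factor \<open>p\<close> instead.\<close>

lemma block_dvd_step:
  assumes S: "block_dvd p m b c" and d: "d = (if p dvd m then 1 else 0)"
    and b': "b' \<le> c" "b' \<le> b + 1 + d" and c': "c' \<le> c + 1" "c' \<le> b + 1 + d"
  shows "block_dvd p (Suc m) b' c'"
proof -
  have m: "0 < m" and A: "r < p \<Longrightarrow> int p ^ b dvd dwork_num p (p * (m - 1) + r)"
    and Z: "int p ^ c dvd dwork_num p (p * m)" for r
    using S by (auto simp: block_dvd_def)
  have pm: "p * m = p * (m - 1) + p" using m by (cases m) auto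
  have dm: "int p ^ d dvd int m" unfolding d by (auto simp: of_nat_dvd_iff)
  have R: "int p ^ (b + 1 + d) dvd dwork_num p (p * m + r) - dwork_num p (p * m)" if "r < p" for r
    using that
  proof (induction r)
    case (Suc r)
    let ?q = "pochhammer (int (Suc (Suc (p * m + r)) - p)) (p - 1)"
    have ix: "p * m + r - (p - 1) = p * (m - 1) + Suc r" using Suc.prems pm by simp
    \<comment> \<open>The \<open>p - 1\<close> consecutive integers multiplied here end at
      \<open>p * m + r\<close> and start at or below \<open>p * m\<close>, because
      \<open>Suc r < p\<close>.\<close>
    have "int (p * m) dvd ?q" by (rule dvd_pochhammer_int) (use Suc.prems pm in auto)
    then have "int p ^ (1 + d) dvd ?q"
      using mult_dvd_mono[OF dvd_refl[of "int p"] dm] by (auto intro: dvd_trans)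
    then have "int p ^ (1 + d) * int p ^ b dvd ?q * dwork_num p (p * (m - 1) + Suc r)"
      using A[of "Suc r"] Suc.prems by (intro mult_dvd_mono) auto
    then have "int p ^ (b + 1 + d) dvd ?q * dwork_num p (p * (m - 1) + Suc r)"
      by (simp add: power_add mult_ac)
    moreover have "dwork_num p (p * m + Suc r)
        = dwork_num p (p * m + r) + ?q * dwork_num p (p * (m - 1) + Suc r)"
      using pm ix by simp
    then have "dwork_num p (p * m + Suc r) - dwork_num p (p * m)
        = (dwork_num p (p * m + r) - dwork_num p (p * m)) + ?q * dwork_num p (p * (m - 1) + Suc r)"
      by (simp only: add_diff_eq diff_add_eq)
    moreover have "int p ^ (b + 1 + d) dvd dwork_num p (p * m + r) - dwork_num p (p * m)"
      using Suc.IH Suc.prems by simp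
    ultimately show ?case by (simp only: dvd_add)
  qed simp
  let ?q = "pochhammer (int p * int m + 1) (p - 1)"
  have "[?q = fact (p - 1)] (mod int p)" by (rule pochhammer_int_fact_cong)
  then have "[?q = -1] (mod int p)" using wilson_theorem[OF p(1)] cong_trans by blast
  then have q: "int p dvd 1 + ?q" by (simp add: cong_iff_dvd_diff add.commute)
  have "dwork_num p (p * Suc m) = dwork_num p (Suc (p * m + (p - 1)))"
    using p_ge_3 by (simp add: algebra_simps)
  also have "\<dots> = dwork_num p (p * m + (p - 1)) + ?q * dwork_num p (p * m)"
  proof -
    have "int (Suc (Suc (p * m + (p - 1))) - p) = int p * int m + 1"
      "p * m + (p - 1) - (p - 1) = p * m" "p \<le> Suc (p * m + (p - 1))"
      using p_ge_3 by auto
    then show ?thesis by (simp only: dwork_num.simps if_True)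
  qed
  \<comment> \<open>Arranged so that the first summand falls under \<open>R\<close> and the second
    contains the Wilson factor \<open>1 + ?q\<close>.\<close>
  finally have E: "dwork_num p (p * Suc m) = (dwork_num p (p * m + (p - 1)) - dwork_num p (p * m))
      + (1 + ?q) * dwork_num p (p * m)" by (simp add: algebra_simps)
  have "int p ^ (c + 1) dvd (1 + ?q) * dwork_num p (p * m)"
    using mult_dvd_mono[OF q Z] by simp
  from power_le_dvd[OF this c'(1)] have "int p ^ c' dvd (1 + ?q) * dwork_num p (p * m)" .
  then have "int p ^ c' dvd dwork_num p (p * Suc m)" unfolding E
    using power_le_dvd[OF R[of "p - 1"] c'(2)] p_ge_3
    by (intro dvd_add) auto
  moreover have "int p ^ b' dvd dwork_num p (p * m + r)" if "r < p" for r
  proof -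
    have "int p ^ b' dvd dwork_num p (p * m + r) - dwork_num p (p * m)"
      using R[OF that] b' power_le_dvd by blast
    moreover have "int p ^ b' dvd dwork_num p (p * m)" using Z b' power_le_dvd by blast
    ultimately show ?thesis by (metis dvd_add diff_add_cancel)
  qed
  ultimately show ?thesis by (simp add: block_dvd_def)
qed

text \<open>Two steps lead from exponents (b, b+1) through (b+1, b+1) to (b+1, b+2). A cycle of
  \<open>p\<close> blocks consists of (p-1)/2 such pairs and one step from a block number divisible
  by \<open>p\<close>, which gains a full factor alone; hence (p+1)/2 per cycle.\<close>

lemma block_dvd_two_step:
  assumes "2 * i < p"
  shows "block_dvd p (p * l + 1 + 2 * i) (l * ((p + 1) div 2) + i) (l * ((p + 1) div 2) + i + 1)"
  using assms
proof (induction l arbitrary: i)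
  have step: "block_dvd p (m + 2) (b + 1) (b + 2)" if "block_dvd p m b (b + 1)" for m b
  proof -
    have "block_dvd p (Suc m) (b + 1) (b + 1)" by (rule block_dvd_step[OF that refl]) auto
    from block_dvd_step[OF this refl, of "b + 1" "b + 2"] show ?thesis by simp
  qed
  have steps: "block_dvd p (m + 2 * i) (b + i) (b + i + 1)" if B: "block_dvd p m b (b + 1)" for m b i
    
  proof (induction i)
    case (Suc i)
    from step[OF this] show ?case by (simp add: algebra_simps)
  qed (use B in simp)
  {
    case 0
    \<comment> \<open>The start (0, 1): all numerators below index \<open>p\<close> are 1, and the
      one at \<open>p\<close> is 1 + (p-1)!.\<close>
    have "[(fact (p - 1) :: int) = -1] (mod int p)" using wilson_theorem[OF p(1)] by simp
    moreover have "dwork_num p (Suc (p - 1)) = 1 + fact (p - 1)"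
    proof -
      have "p \<le> Suc (p - 1)" "int (Suc (Suc (p - 1)) - p) = 1" "p - 1 - (p - 1) = 0" "p - 1 < p"
        using p_ge_3 by auto
      then show ?thesis
        by (simp only: dwork_num.simps if_True dwork_num_small pochhammer_fact mult_1_right)
    qed
    ultimately have "int p dvd dwork_num p p"
      using p_ge_3 by (simp add: cong_iff_dvd_diff add.commute del: dwork_num.simps)
    then have "block_dvd p 1 0 1"
      by (simp add: block_dvd_def)
    from steps[of 1 0 i] this show ?case by simp
  next
    case (Suc l)
    let ?h = "(p + 1) div 2"
    have *: "2 * ((p - 1) div 2) = p - 1" "(p - 1) div 2 + 1 = ?h" using p(2) p_ge_3 by (auto elim: oddE)
    have "block_dvd p (p * l + 1 + 2 * ((p - 1) div 2)) (l * ?h + (p - 1) div 2) (l * ?h + (p - 1) div 2 + 1)"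
      using p_ge_3 by (intro Suc.IH) (simp add: *)
    then have "block_dvd p (p * Suc l) (l * ?h + (p - 1) div 2) (l * ?h + (p - 1) div 2 + 1)"
      using * p_ge_3 by (simp add: algebra_simps)
    \<comment> \<open>Here \<open>d = 1\<close>, so this single step raises both exponents.\<close>
    from block_dvd_step[OF this refl, of "Suc l * ?h" "Suc l * ?h + 1"]
    have "block_dvd p (p * Suc l + 1) (Suc l * ?h) (Suc l * ?h + 1)"
      using *(2) by simp
    from steps[OF this, of i] show ?case by simp
  }
qed

lemma power_dvd_dwork_num: "int p ^ ((k div p\<^sup>2) * ((p + 1) div 2)) dvd dwork_num p k"
proof -
  define l m j where "l = k div p\<^sup>2" and "m = k div p" and "j = m mod p"
  let ?h = "(p + 1) div 2"
  have m: "m = p * l + j" by (simp add: l_def m_def j_def power2_eq_square div_mult2_eq)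
  have j: "j < p" using p_ge_3 by (simp add: j_def)
  define i where "i = j div 2"
  have "2 * i < p" using j by (simp add: i_def)
  note M = block_dvd_two_step[OF this, of l]
  \<comment> \<open>Index \<open>k\<close> lies in the block starting at \<open>p * m\<close>, which
    is the first clause of \<open>block_dvd\<close> at \<open>Suc m\<close>. Odd \<open>j\<close>
    falls between two double steps and costs one single step more.\<close>
  have "\<exists>b c. l * ?h \<le> b \<and> block_dvd p (Suc m) b c"
  proof (cases "even j")
    case True
    then have "Suc m = p * l + 1 + 2 * i" by (simp add: m i_def)
    then show ?thesis using M le_add1 by metis
  next
    case False
    then have "Suc m = Suc (p * l + 1 + 2 * i)" by (simp add: m i_def)
    then have "block_dvd p (Suc m) (l * ?h + i + 1) (l * ?h + i + 1)"
      using block_dvd_step[OF M refl] by simp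
    then show ?thesis by (metis add.assoc le_add1)
  qed
  then obtain b c where "l * ?h \<le> b" "block_dvd p (Suc m) b c" by blast
  then have "int p ^ b dvd dwork_num p (p * m + k mod p)"
    using p_ge_3 by (simp add: block_dvd_def)
  then show ?thesis using \<open>l * ?h \<le> b\<close> power_le_dvd by (auto simp: m_def l_def)
qed

end

section \<open>Nonarchimedean absolute values\<close>

lemma absval_nonneg [simp]: "0 \<le> absval (x :: 'a::nonarch_field)"
  using zero_le_dist[of x 0] by (simp add: dist_absval)

lemma absval_zero [simp]: "absval (0 :: 'a::nonarch_field) = 0"
  using dist_absval[of "0 :: 'a" 0] by simp

lemma absval_eq_0_iff [simp]: "absval (x :: 'a::nonarch_field) = 0 \<longleftrightarrow> x = 0"
  using dist_absval[of x 0] by auto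

lemma absval_pos_iff [simp]: "0 < absval (x :: 'a::nonarch_field) \<longleftrightarrow> x \<noteq> 0"
  using absval_nonneg[of x] absval_eq_0_iff[of x] by linarith

lemma absval_one [simp]: "absval (1 :: 'a::nonarch_field) = 1"
  using absval_mult[of "1 :: 'a" 1] by simp

lemma absval_minus_commute: "absval (x - y) = absval (y - x :: 'a::nonarch_field)"
  by (metis dist_absval dist_commute)

lemma absval_minus [simp]: "absval (- x :: 'a::nonarch_field) = absval x"
  using absval_minus_commute[of 0 x] by simp

lemma absval_power: "absval (x ^ n :: 'a::nonarch_field) = absval x ^ n"
  by (induction n) (simp_all add: absval_mult)

lemma absval_inverse: "absval (inverse x :: 'a::nonarch_field) = inverse (absval x)"
proof (cases "x = 0")
  case False
  then have "absval x * absval (inverse x) = 1" by (simp flip: absval_mult)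
  then show ?thesis by (simp add: inverse_unique)
qed simp

lemma absval_divide: "absval (x / y :: 'a::nonarch_field) = absval x / absval y"
  by (simp add: divide_inverse absval_mult absval_inverse)

lemma absval_add_le: "absval x \<le> c \<Longrightarrow> absval y \<le> c \<Longrightarrow> absval (x + y :: 'a::nonarch_field) \<le> c"
  using absval_add[of x y] by linarith

lemma absval_diff_le: "absval x \<le> c \<Longrightarrow> absval y \<le> c \<Longrightarrow> absval (x - y :: 'a::nonarch_field) \<le> c"
  using absval_add_le[of x c "- y"] by simp

lemma absval_sum_le:
  "0 \<le> c \<Longrightarrow> (\<And>i. i \<in> A \<Longrightarrow> absval (g i :: 'a::nonarch_field) \<le> c) \<Longrightarrow> absval (sum g A) \<le> c"
  by (induction A rule: infinite_finite_induct) (auto intro: absval_add_le)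

lemma absval_of_nat_le_1: "absval (of_nat n :: 'a::nonarch_field) \<le> 1"
  by (induction n) (auto intro: absval_add_le)

lemma absval_of_int_le_1: "absval (of_int n :: 'a::nonarch_field) \<le> 1"
  using absval_of_nat_le_1[where 'a = 'a] by (cases n) (simp_all del: of_nat_Suc)

text \<open>By the ultrametric inequality a block of terms is no larger than its largest term, so
  the partial sums are Cauchy. The bound \<open>M n\<close> on their distances survives the limit
  and becomes the tail estimate.\<close>

lemma nonarch_summable:
  fixes g :: "nat \<Rightarrow> 'a::{nonarch_field, complete_space}"
  assumes g: "\<And>k. absval (g k) \<le> M k" and M: "decseq M" "M \<longlonglongrightarrow> 0"
  shows nonarch_summableI: "summable g"
    and nonarch_suminf_tail: "absval (suminf g - sum g {..<n}) \<le> M n"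
proof -
  define S where "S n = sum g {..<n}" for n
  have M0: "0 \<le> M k" for k using absval_nonneg g order_trans by blast
  have d: "dist (S m) (S n) \<le> M n" if "n \<le> m" for m n
  proof -
    have "S m - S n = sum g {n..<m}"
      using that by (simp add: S_def lessThan_atLeast0 sum_diff_nat_ivl)
    moreover have "absval (sum g {n..<m}) \<le> M n"
    proof (rule absval_sum_le[OF M0])
      fix i assume "i \<in> {n..<m}"
      then show "absval (g i) \<le> M n"
        using order_trans[OF g[of i] decseqD[OF M(1), of n i]] by simp
    qed
    ultimately show ?thesis by (simp add: dist_absval)
  qed
  have "Cauchy S"
  proof (rule metric_CauchyI)
    fix e :: real assume e: "0 < e"
    then obtain N where N: "M N < e"
      using order_tendstoD(2)[OF M(2) e] by (auto simp: eventually_sequentially)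
    have N': "M n < e" if "N \<le> n" for n
      using N decseqD[OF M(1) that] by linarith
    have "dist (S m) (S n) < e" if "N \<le> m" "N \<le> n" for m n
      using d[of n m] d[of m n, unfolded dist_commute[of "S n"]] N'[OF that(1)] N'[OF that(2)]
      by linarith
    then show "\<exists>N. \<forall>m\<ge>N. \<forall>n\<ge>N. dist (S m) (S n) < e" by blast
  qed
  then obtain L where L: "S \<longlonglongrightarrow> L"
    using Cauchy_convergent convergent_def by blast
  then have gL: "g sums L" unfolding sums_def S_def .
  then show "summable g" by (rule sums_summable)
  have "dist L (S n) \<le> M n"
    using tendsto_dist[OF L tendsto_const[of "S n"]] d by (intro LIMSEQ_le_const2) auto
  then show "absval (suminf g - sum g {..<n}) \<le> M n"
    using sums_unique[OF gL] by (simp add: dist_absval S_def)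
qed

section \<open>Recursion for the coefficients of the Dwork exponential, and factorials\<close>

lemma dwork_exp_nth_0 [simp]: "fps_nth (dwork_exp p) 0 = 1"
  by (simp add: dwork_exp_def)

lemma fps_deriv_dwork_exp:
  assumes "p > 0"
  shows "fps_deriv (dwork_exp p) = (1 + fps_X ^ (p - 1)) * (dwork_exp p :: 'a::field_char_0 fps)"
proof -
  have 0: "fps_nth (fps_const (1 / of_nat p) * fps_X ^ p + fps_X :: 'a fps) 0 = 0"
    using assms by simp
  have "fps_deriv (fps_const (1 / of_nat p) * fps_X ^ p + fps_X :: 'a fps) = 1 + fps_X ^ (p - 1)"
    using assms by (intro fps_ext) (auto simp: fps_X_power_iff fps_nth_Abs_fps)
  then show ?thesis
    unfolding dwork_exp_def fps_compose_deriv[OF 0] by simp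
qed

lemma dwork_exp_nth_Suc:
  assumes "p > 0"
  shows "of_nat (Suc k) * fps_nth (dwork_exp p) (Suc k) =
    fps_nth (dwork_exp p) k + (if p \<le> Suc k then fps_nth (dwork_exp p) (k - (p - 1)) else 0 :: 'a::field_char_0)"
proof -
  have "of_nat (Suc k) * fps_nth (dwork_exp p) (Suc k) = fps_nth (fps_deriv (dwork_exp p)) k"
    by simp
  also have "\<dots> = fps_nth (dwork_exp p + fps_X ^ (p - 1) * dwork_exp p) k"
    unfolding fps_deriv_dwork_exp[OF assms] by (simp only: distrib_right mult_1_left)
  also have "\<dots> = fps_nth (dwork_exp p) k + (if p \<le> Suc k then fps_nth (dwork_exp p) (k - (p - 1)) else 0)"
  proof -
    have "k < p - 1 \<longleftrightarrow> \<not> p \<le> Suc k" using assms by linarith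
    then show ?thesis by (simp only: fps_add_nth fps_X_power_mult_nth if_not_P) simp
  qed
  finally show ?thesis .
qed

text \<open>Multiplying the coefficient recursion by n! clears denominators; the quotient
  n!/(n-p+1)! is the \<open>pochhammer\<close> factor in \<open>dwork_num\<close>.\<close>

lemma dwork_exp_nth:
  assumes "p > 0"
  shows "fact k * fps_nth (dwork_exp p) k = (of_int (dwork_num p k) :: 'a::field_char_0)"
proof (induction k rule: less_induct)
  case (less k)
  show ?case
  proof (cases k)
    case (Suc n)
    let ?B = "fps_nth (dwork_exp p) :: nat \<Rightarrow> 'a"
    have "fact k * ?B k = fact n * (of_nat (Suc n) * ?B (Suc n))" by (simp add: Suc mult_ac)
    also have "\<dots> = fact n * ?B n + (if p \<le> Suc n then fact n * ?B (n - (p - 1)) else 0)"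
      unfolding dwork_exp_nth_Suc[OF assms] by (simp add: distrib_left)
    also have "\<dots> = of_int (dwork_num p k)"
    proof (cases "p \<le> Suc n")
      case True
      define m where "m = n - (p - 1)"
      have n: "n = m + (p - 1)" using True assms by (simp add: m_def)
      have "(fact n :: int) = fact m * pochhammer (int (Suc (Suc n) - p)) (p - 1)"
        using assms pochhammer_product'[of "1 :: int" m "p - 1"] unfolding pochhammer_fact
        by (simp add: n Suc_diff_le)
      from this[THEN arg_cong[where f = "of_int :: int \<Rightarrow> 'a"]]
      have "(fact n :: 'a) = of_int (pochhammer (int (Suc (Suc n) - p)) (p - 1)) * fact m"
        by simp
      then have "(fact n :: 'a) * ?B m = of_int (pochhammer (int (Suc (Suc n) - p)) (p - 1) * dwork_num p m)"
        using less[of m] Suc n by (simp add: mult_ac)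
      then show ?thesis using less[of n] Suc True by (simp add: m_def)
    qed (use less[of n] Suc in simp)
    finally show ?thesis .
  qed simp
qed

text \<open>The multiples of \<open>p\<close> among the factors contribute
  \<open>p ^ m * fact m\<close>; the remaining factors are prime to \<open>p\<close>.\<close>

lemma fact_p_decomp:
  assumes "prime p" "r < p"
  shows "\<exists>u. fact (p * m + r) = p ^ m * fact m * u \<and> \<not> p dvd u"
  using assms(2)
proof (induction m arbitrary: r)
  have p: "\<not> p dvd x * y" if "\<not> p dvd x" "\<not> p dvd y" for x y
    using that assms(1) by (simp add: prime_dvd_mult_iff)
  have step: "\<exists>u. fact (p * m + r) = p ^ m * fact m * u \<and> \<not> p dvd u"
    if "\<exists>u. fact (p * m) = p ^ m * fact m * u \<and> \<not> p dvd u" "r < p" for m r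
    using that(2)
  proof (induction r)
    case (Suc r)
    then obtain u where u: "fact (p * m + r) = p ^ m * fact m * u" "\<not> p dvd u" by auto
    have "\<not> p dvd p * m + Suc r"
      using Suc.prems by (subst dvd_add_right_iff) (auto dest: dvd_imp_le)
    from p[OF u(2) this] show ?case
      using u(1) by (intro exI[of _ "u * (p * m + Suc r)"]) (simp add: algebra_simps)
  qed (use that in simp)
  {
    case 0
    from step[of 0 r] 0 show ?case using prime_gt_1_nat[OF assms(1)] by auto
  next
    case (Suc m)
    have p1: "p > 1" using prime_gt_1_nat[OF assms(1)] .
    then obtain u where u: "fact (p * m + (p - 1)) = p ^ m * fact m * u" "\<not> p dvd u"
      using Suc.IH[of "p - 1"] by auto
    have "p * Suc m = Suc (p * m + (p - 1))" using p1 by simp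
    then have "fact (p * Suc m) = (p * Suc m) * fact (p * m + (p - 1))"
      by (metis fact_Suc of_nat_id)
    also have "\<dots> = p ^ Suc m * fact (Suc m) * u"
      unfolding u(1) by (simp add: algebra_simps)
    finally show ?case using u(2) step[of "Suc m" r] Suc.prems by blast
  }
qed

section \<open>p-adic sizes of integers and factorials, and decay of the terms\<close>

locale padic_absval =
  fixes p :: nat and type :: "'a::{nonarch_field, complete_space} itself"
  assumes p: "prime p" "odd p" and absval_p: "absval (of_nat p :: 'a) = 1 / real p"
begin

text \<open>In a Bezout relation u p + v n = 1 the first summand has absolute value below 1, so the
  second must reach 1.\<close>

lemma absval_of_nat_unit:
  assumes "\<not> p dvd n"
  shows "absval (of_nat n :: 'a) = 1"
proof -
  have "coprime (int p) (int n)"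
    using assms p(1) by (simp add: prime_imp_coprime)
  then obtain u v where "u * int p + v * int n = 1"
    using bezout_int[of "int p" "int n"] by auto
  then have "of_int u * of_nat p + of_int v * of_nat n = (1 :: 'a)"
    by (metis of_int_1 of_int_add of_int_mult of_int_of_nat_eq)
  then have "1 \<le> max (absval (of_int u * of_nat p :: 'a)) (absval (of_int v * of_nat n :: 'a))"
    by (metis absval_add absval_one)
  moreover have "absval (of_int u * of_nat p :: 'a) \<le> 1 / real p"
    using absval_of_int_le_1[of u, where 'a = 'a]
    by (simp add: absval_mult absval_p divide_right_mono)
  moreover have "1 / real p < 1" using p_ge_3[OF p] by simp
  moreover have "absval (of_int v * of_nat n :: 'a) \<le> absval (of_nat n :: 'a)"
    using absval_of_int_le_1[of v, where 'a = 'a]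
    by (simp add: absval_mult mult_left_le_one_le)
  ultimately have "1 \<le> absval (of_nat n :: 'a)" by linarith
  then show ?thesis using absval_of_nat_le_1[of n, where 'a = 'a] by linarith
qed

lemma absval_of_int_power_dvd:
  assumes "int p ^ e dvd n"
  shows "absval (of_int n :: 'a) \<le> (1 / real p) ^ e"
proof -
  from assms obtain c where "n = int p ^ e * c" by auto
  then show ?thesis
    using absval_of_int_le_1[of c, where 'a = 'a]
    by (simp add: absval_mult absval_power absval_p mult_left_le del: of_nat_power)
qed

text \<open>Legendre's estimate: the valuation of k! is at most k/(p-1). The power
  \<open>p - 1\<close> keeps the exponents integral.\<close>

lemma absval_fact: "(1 / real p) ^ k \<le> absval (fact k :: 'a) ^ (p - 1)"
proof (induction k rule: less_induct)
  case (less k)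
  define m r where "m = k div p" and "r = k mod p"
  have k: "k = p * m + r" and r: "r < p" using p_ge_3[OF p] by (auto simp: m_def r_def)
  obtain u where u: "fact (p * m + r) = p ^ m * fact m * u" "\<not> p dvd u"
    using fact_p_decomp[OF p(1) r] by blast
  have "absval (of_nat (fact k) :: 'a) = (1 / real p) ^ m * absval (of_nat (fact m) :: 'a)"
    unfolding k u(1) by (simp add: absval_mult absval_power absval_p absval_of_nat_unit[OF u(2)])
  then have *: "absval (fact k :: 'a) ^ (p - 1) = (1 / real p) ^ (m * (p - 1)) * absval (fact m :: 'a) ^ (p - 1)"
    by (simp add: power_mult_distrib power_mult)
  show ?case
  proof (cases "m = 0")
    case True
    then show ?thesis using * p_ge_3[OF p] by (simp add: power_le_one)
  next
    case False
    have "m * (p - 1) + m = p * m" using p_ge_3[OF p] by (cases p) auto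
    then have "(1 / real p) ^ k = (1 / real p) ^ (m * (p - 1)) * (1 / real p) ^ m * (1 / real p) ^ r"
      unfolding k by (metis power_add)
    also have "\<dots> \<le> (1 / real p) ^ (m * (p - 1)) * (1 / real p) ^ m"
      using p_ge_3[OF p] by (intro mult_left_le) (auto intro: power_le_one)
    also have "\<dots> \<le> (1 / real p) ^ (m * (p - 1)) * absval (fact m :: 'a) ^ (p - 1)"
    proof (intro mult_left_mono)
      have "1 * m < p * m" using False p_ge_3[OF p] by (intro mult_strict_right_mono) auto
      then have "m < k" unfolding k by linarith
      then show "(1 / real p) ^ m \<le> absval (fact m :: 'a) ^ (p - 1)" by (rule less)
    qed simp
    finally show ?thesis using * by simp
  qed
qed

text \<open>
  Up to a constant, this bounds \<open>B\<^sub>k\<close> times a Stirling number: the gains \<open>k/p\<^sup>2 * (p+1)/2\<close> from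
  \<open>k! B\<^sub>k\<close> and \<open>k/p\<close> from the Stirling number exceed the loss \<open>k/(p-1)\<close> from \<open>k!\<close>.
\<close>

definition decay :: "nat \<Rightarrow> real" where
  "decay k = real p powr - (real (k div p\<^sup>2) / real (p - 1))"

lemma decay_nonneg: "0 \<le> decay k"
  by (simp add: decay_def)

lemma decay_le_1: "decay k \<le> 1"
  using powr_mono[of "- (real (k div p\<^sup>2) / real (p - 1))" 0 "real p"] p_ge_3[OF p]
  by (simp add: decay_def)

lemma decseq_decay: "decseq decay"
  unfolding decseq_def
proof (intro allI impI)
  fix m n :: nat
  assume "m \<le> n"
  then have "real (m div p\<^sup>2) / real (p - 1) \<le> real (n div p\<^sup>2) / real (p - 1)"
    by (simp add: div_le_mono divide_right_mono)
  then show "decay n \<le> decay m"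
    using p_ge_3[OF p] unfolding decay_def by (intro powr_mono) simp_all
qed

lemma decay_tendsto: "decay \<longlonglongrightarrow> 0"
proof -
  have p3: "3 \<le> p" using p_ge_3[OF p] .
  have "filterlim (\<lambda>k. k div p\<^sup>2) at_top sequentially"
    unfolding filterlim_at_top
  proof
    fix Z :: nat
    show "\<forall>\<^sub>F k in sequentially. Z \<le> k div p\<^sup>2"
      using eventually_ge_at_top[of "Z * p\<^sup>2"]
      by eventually_elim (use p3 in \<open>simp add: less_eq_div_iff_mult_less_eq\<close>)
  qed
  then have "(\<lambda>k. (real p powr - (1 / real (p - 1))) ^ (k div p\<^sup>2)) \<longlonglongrightarrow> 0"
    using p3 by (intro filterlim_compose[OF LIMSEQ_power_zero]) (auto simp: powr_less_one)
  moreover have "(real p powr - (1 / real (p - 1))) ^ (k div p\<^sup>2) = decay k" for k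
    using p3 by (simp add: decay_def powr_powr flip: powr_realpow)
  ultimately show ?thesis by simp
qed

text \<open>The valuation balance multiplied by \<open>p - 1\<close>: \<open>k\<close> is the loss
  from k!, and the extra \<open>k div p\<^sup>2\<close> on the left is the surplus that becomes
  \<open>decay\<close>. The constant 2 pays for the last two base-p digits \<open>q\<close> and
  \<open>r\<close> of \<open>k\<close>.\<close>

lemma exponent_ineq:
  defines "h \<equiv> (p + 1) div 2"
  shows "k + k div p\<^sup>2 \<le> (p - 1) * ((k div p\<^sup>2) * h + k div p + 2)"
proof -
  define l q r where "l = k div p\<^sup>2" and "q = k div p mod p" and "r = k mod p"
  have p3: "3 \<le> p" using p_ge_3[OF p] .
  have kp: "k div p = p * l + q"
    by (simp add: l_def q_def power2_eq_square div_mult2_eq)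
  have k: "k = p * (p * l + q) + r"
    using kp by (metis r_def mult_div_mod_eq)
  have qr: "q \<le> p - 1" "r \<le> p - 1" using p3 by (auto simp: q_def r_def less_Suc_eq_le[symmetric])
  obtain a where a: "p = 2 * a + 1" using p(2) by (elim oddE)
  then have "a \<ge> 1" using p3 by simp
  \<comment> \<open>With p = 2a + 1 this compares 4a^2 + 4a + 2 with 6a^2 + 4a; equality holds for p
    = 3.\<close>
  have "l * (p * p + 1) \<le> l * ((p - 1) * (h + p))"
  proof (rule mult_left_mono)
    have "1 * 1 \<le> a * a" using \<open>a \<ge> 1\<close> by (intro mult_mono) auto
    moreover have "a * 1 \<le> a * a" using \<open>a \<ge> 1\<close> by (intro mult_mono) auto
    ultimately show "p * p + 1 \<le> (p - 1) * (h + p)"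
      by (simp add: a h_def algebra_simps)
  qed simp
  moreover have "p * q + r \<le> (p - 1) * q + (p - 1) * 2"
  proof -
    have "p * q = (p - 1) * q + q" using p3 by (cases p) auto
    then show ?thesis using qr by linarith
  qed
  ultimately show ?thesis unfolding kp l_def[symmetric]
    by (subst k) (simp add: algebra_simps)
qed

text \<open>The factor p^s undoes the scaling in \<open>power_dvd_stirling\<close>, and p^2 comes
  from the constant in \<open>exponent_ineq\<close>. Both sides are compared after raising to the
  power \<open>p - 1\<close>, where the factorial bound and \<open>decay\<close> have integer
  exponents.\<close>

lemma dwork_stirling_bound:
  "absval (fps_nth (dwork_exp p) k * of_nat (stirling k s) :: 'a) \<le> real p ^ (s + 2) * decay k"
proof -
  let ?h = "(p + 1) div 2" let ?l = "k div p\<^sup>2" let ?i = "1 / real p"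
  have p3: "3 \<le> p" using p_ge_3[OF p] .
  define W S F where "W = absval (of_int (dwork_num p k) :: 'a)"
    and "S = absval (of_nat (stirling k s) :: 'a)" and "F = absval (fact k :: 'a)"
  have F0: "F > 0" by (simp add: F_def)
  have W: "W \<le> ?i ^ (?l * ?h)"
    unfolding W_def by (intro absval_of_int_power_dvd power_dvd_dwork_num p)
  have "absval (of_int (int (p ^ s * stirling k s)) :: 'a) \<le> ?i ^ (k div p)"
    using power_dvd_stirling[of p k s]
    by (intro absval_of_int_power_dvd) (metis of_nat_dvd_iff of_nat_power)
  then have "?i ^ s * S \<le> ?i ^ (k div p)"
    by (simp add: S_def absval_mult absval_power absval_p)
  then have S: "S \<le> real p ^ s * ?i ^ (k div p)"
    using p3 by (simp add: field_simps)
  have WS: "W * S \<le> ?i ^ (?l * ?h) * (real p ^ s * ?i ^ (k div p))"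
    by (rule mult_mono[OF W S]) (simp_all add: S_def)
  have "absval (fps_nth (dwork_exp p) k * of_nat (stirling k s) :: 'a) = W * S / F"
  proof -
    have "W = F * absval (fps_nth (dwork_exp p) k :: 'a)"
      using p3 dwork_exp_nth[of p k, where 'a = 'a] by (simp add: W_def F_def flip: absval_mult)
    then show ?thesis using F0 by (simp add: absval_mult S_def)
  qed
  also have "\<dots> \<le> real p ^ (s + 2) * decay k"
  proof (rule power_le_imp_le_base)
    have dk: "decay k ^ (p - 1) = ?i ^ ?l"
      using p3 by (simp add: decay_def powr_power powr_minus powr_realpow power_divide inverse_eq_divide)
    have "(W * S / F) ^ (p - 1) \<le> (W * S) ^ (p - 1) / ?i ^ k"
      unfolding power_divide[of "W * S" F]
      using absval_fact[of k] p3 F0 by (intro divide_left_mono) (simp_all add: F_def W_def S_def)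
    also have "\<dots> \<le> (?i ^ (?l * ?h) * (real p ^ s * ?i ^ (k div p))) ^ (p - 1) / ?i ^ k"
      by (intro divide_right_mono power_mono WS) (simp_all add: W_def S_def)
    also have "\<dots> = real p ^ (s * (p - 1)) * real p ^ k * ?i ^ ((p - 1) * (?l * ?h + k div p))"
    proof -
      have "(p - 1) * (?l * ?h + k div p) = ?l * ?h * (p - 1) + k div p * (p - 1)"
        by (metis distrib_right mult.commute)
      moreover have "x / ?i ^ k = real p ^ k * x" for x
        by (simp add: power_divide)
      ultimately show ?thesis
        by (simp only: power_mult_distrib power_add power_mult[symmetric] mult_ac)
    qed
    also have "\<dots> \<le> real p ^ (s * (p - 1)) * (real p ^ ((p - 1) * 2) * ?i ^ ?l)"
    proof -
      have div: "a / z \<le> v / y" if "a * y \<le> z * v" "z > 0" "y > 0" for a y z v :: real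
        using that by (simp add: field_simps)
      have "real p ^ (k + ?l) \<le> real p ^ ((p - 1) * (?l * ?h + k div p) + (p - 1) * 2)"
        using exponent_ineq[of k] p3 by (intro power_increasing) (auto simp: algebra_simps)
      then have "real p ^ k * real p ^ ?l \<le> real p ^ ((p - 1) * (?l * ?h + k div p)) * real p ^ ((p - 1) * 2)"
        by (simp only: power_add)
      then have "real p ^ k * ?i ^ ((p - 1) * (?l * ?h + k div p)) \<le> real p ^ ((p - 1) * 2) * ?i ^ ?l"
        using p3 div[of "real p ^ k" "real p ^ ?l" "real p ^ ((p - 1) * (?l * ?h + k div p))"]
        by (simp add: power_divide)
      from mult_left_mono[OF this, of "real p ^ (s * (p - 1))"] show ?thesis by (simp add: mult.assoc)
    qed
    also have "\<dots> = (real p ^ (s + 2) * decay k) ^ (p - 1)"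
      by (simp only: power_mult_distrib dk power_add power_mult[symmetric] mult_ac)
    finally have le: "(W * S / F) ^ (p - 1) \<le> (real p ^ (s + 2) * decay k) ^ (p - 1)" .
    have "Suc (p - 2) = p - 1" using p3 by simp
    then show "(W * S / F) ^ (Suc (p - 2)) \<le> (real p ^ (s + 2) * decay k) ^ (Suc (p - 2))"
      using le by (simp only:)
  qed (simp add: decay_nonneg)
  finally show ?thesis .
qed

end

section \<open>The interpolating series\<close>

definition units_upto :: "nat \<Rightarrow> nat \<Rightarrow> nat set" where
  "units_upto p n = {j. 1 \<le> j \<and> j \<le> n \<and> \<not> p dvd j}"

lemma finite_units_upto [simp]: "finite (units_upto p n)"
  by (rule finite_subset[of _ "{..n}"]) (auto simp: units_upto_def)

lemma units_upto_add:
  assumes "p dvd m"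
  shows "units_upto p (m + n) = units_upto p m \<union> (\<lambda>j. m + j) ` units_upto p n" (is "?L = ?R")
proof
  show "?L \<subseteq> ?R"
  proof
    fix j assume j: "j \<in> ?L"
    show "j \<in> ?R"
    proof (cases "j \<le> m")
      case False
      have "\<not> p dvd j - m"
      proof
        assume "p dvd j - m"
        from dvd_add[OF assms this] show False using j False by (simp add: units_upto_def)
      qed
      then have "j - m \<in> units_upto p n" using j False by (auto simp: units_upto_def)
      then have "m + (j - m) \<in> (\<lambda>j. m + j) ` units_upto p n" by (rule imageI)
      then show ?thesis using False by simp
    qed (use j in \<open>simp add: units_upto_def\<close>)
  qed
  show "?R \<subseteq> ?L"
    using assms by (auto simp: units_upto_def dvd_add_right_iff)
qed

lemma units_upto_disjoint: "units_upto p m \<inter> (\<lambda>j. m + j) ` units_upto p n = {}"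
  by (auto simp: units_upto_def)

lemma sum_units_upto_add:
  "p dvd m \<Longrightarrow> sum g (units_upto p (m + n)) = sum g (units_upto p m) + (\<Sum>j\<in>units_upto p n. g (m + j))"
  by (simp add: units_upto_add units_upto_disjoint sum.union_disjoint sum.reindex)

lemma prod_units_upto_add:
  "p dvd m \<Longrightarrow> prod g (units_upto p (m + n)) = prod g (units_upto p m) * (\<Prod>j\<in>units_upto p n. g (m + j))"
  by (simp add: units_upto_add units_upto_disjoint prod.union_disjoint prod.reindex)

text \<open>As \<open>p\<close> divides \<open>n\<close>, the endpoint \<open>n\<close> is not in
  the set, so \<open>n - j\<close> is never 0.\<close>

lemma units_upto_reflect:
  assumes "p dvd n"
  shows "bij_betw (\<lambda>j. n - j) (units_upto p n) (units_upto p n)"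
proof (rule bij_betwI[where g = "\<lambda>j. n - j"])
  have "n - j \<in> units_upto p n" if "j \<in> units_upto p n" for j
  proof -
    have "j \<noteq> n" using that assms by (auto simp: units_upto_def)
    moreover have "\<not> p dvd n - j"
      using dvd_diffD1[OF _ assms, of j] that by (auto simp: units_upto_def)
    ultimately show ?thesis using that by (auto simp: units_upto_def)
  qed
  then show "(\<lambda>j. n - j) \<in> units_upto p n \<rightarrow> units_upto p n" by blast
  then show "(\<lambda>j. n - j) \<in> units_upto p n \<rightarrow> units_upto p n" .
qed (auto simp: units_upto_def)

text \<open>The value at \<open>-n\<close> of the interpolating series \<open>\<Sum>k. B\<^sub>k t(t+1)\<dots>(t+k-1)\<close>,
  whose \<open>t\<^sup>s\<close>-coefficient is \<open>[(D 1/x)\<^sup>s f]\<^sub>0\<close>.\<close>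

definition dwork_eval :: "nat \<Rightarrow> nat \<Rightarrow> 'a::field_char_0" where
  "dwork_eval p n = (\<Sum>k\<le>n. fps_nth (dwork_exp p) k * pochhammer (- of_nat n) k)"

text \<open>This is \<open>exp(x) f(-x) = exp(-x^p/p)\<close> for odd \<open>p\<close>.\<close>

definition dwork_twist :: "nat \<Rightarrow> 'a::field_char_0 fps" where
  "dwork_twist p = fps_exp 1 * Abs_fps (\<lambda>k. (-1) ^ k * fps_nth (dwork_exp p) k)"

text \<open>Since (-n)(-n+1)...(-n+k-1) = (-1)^k n!/(n-k)!, the sum is n! times a Cauchy product
  with the exponential series.\<close>

lemma dwork_eval_twist: "dwork_eval p n = fact n * fps_nth (dwork_twist p) n"
proof -
  have "fps_nth (dwork_twist p) n
      = (\<Sum>k\<le>n. (-1) ^ k * fps_nth (dwork_exp p) k * (1 / fact (n - k)) :: 'a)"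
    unfolding dwork_twist_def
    by (subst mult.commute) (simp add: fps_mult_nth atLeast0AtMost)
  also have "fact n * \<dots> = dwork_eval p n"
    unfolding dwork_eval_def sum_distrib_left
  proof (rule sum.cong)
    fix k assume "k \<in> {..n}"
    then have "fact n = fact (n - k) * pochhammer (of_nat n - of_nat k + 1 :: 'a) k"
      using pochhammer_product'[of "1 :: 'a" "n - k" k]
      by (simp add: pochhammer_fact of_nat_diff add.commute)
    then show "fact n * ((-1) ^ k * fps_nth (dwork_exp p) k * (1 / fact (n - k)))
        = fps_nth (dwork_exp p) k * pochhammer (- of_nat n :: 'a) k"
      by (simp add: pochhammer_minus)
  qed simp
  finally show ?thesis ..
qed

text \<open>The differential equation of exp(-x^p/p). Replacing x by -x keeps x^(p-1) because
  \<open>p\<close> is odd, and the factor exp(x) cancels the term \<open>- g\<close>.\<close>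

lemma fps_deriv_dwork_twist:
  assumes "odd p"
  shows "fps_deriv (dwork_twist p) = - (fps_X ^ (p - 1) * (dwork_twist p :: 'a::field_char_0 fps))"
proof -
  have p: "p > 0" using assms odd_pos by blast
  define g where "g = (Abs_fps (\<lambda>k. (-1) ^ k * fps_nth (dwork_exp p) k) :: 'a fps)"
  have "fps_deriv g = - g - fps_X ^ (p - 1) * g"
  proof (rule fps_ext)
    fix k
    have "fps_nth (fps_deriv g) k = - ((-1) ^ k) * (of_nat (Suc k) * fps_nth (dwork_exp p) (Suc k))"
      by (simp add: g_def mult_ac)
    also have "\<dots> = - ((-1) ^ k) * fps_nth (dwork_exp p) k
        - (if p \<le> Suc k then (-1) ^ k * fps_nth (dwork_exp p) (k - (p - 1)) else 0)"
      unfolding dwork_exp_nth_Suc[OF p] by (simp add: algebra_simps)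
    also have "\<dots> = fps_nth (- g - fps_X ^ (p - 1) * g) k"
    proof (cases "p \<le> Suc k")
      case True
      have "even (p - 1)" using assms by simp
      moreover have "k = (k - (p - 1)) + (p - 1)" using True p by simp
      ultimately have "(-1 :: 'a) ^ k = (-1) ^ (k - (p - 1))"
        by (metis power_add neg_one_even_power mult_1_right)
      moreover have "\<not> k < p - 1" using True p by simp
      ultimately show ?thesis using True by (simp add: g_def fps_X_power_mult_nth)
    next
      case False
      then show ?thesis using p by (auto simp: g_def fps_X_power_mult_nth)
    qed
    finally show "fps_nth (fps_deriv g) k = fps_nth (- g - fps_X ^ (p - 1) * g) k" .
  qed
  then show ?thesis
    unfolding dwork_twist_def g_def[symmetric] fps_deriv_mult fps_exp_deriv
    by (simp only:) (simp add: algebra_simps)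
qed

text \<open>The differential equation links the coefficients at \<open>p * m\<close> and
  \<open>p * Suc m\<close> by the factor -1/(p(m+1)). Multiplied by the factorial, this cancels the
  multiple of \<open>p\<close> and leaves the \<open>p - 1\<close> new units.\<close>

lemma dwork_eval_multiple:
  assumes "odd p"
  shows "dwork_eval p (p * m) = ((-1) ^ m * (\<Prod>j\<in>units_upto p (p * m). of_nat j) :: 'a::field_char_0)"
proof (induction m)
  case 0
  have "units_upto p 0 = {}" by (auto simp: units_upto_def)
  then show ?case by (simp add: dwork_eval_def)
next
  case (Suc m)
  have p: "p > 0" using assms odd_pos by blast
  let ?y = "dwork_twist p :: 'a fps" and ?n = "p * m + (p - 1)"
  have n: "p * Suc m = Suc ?n" using p by simp
  have U: "units_upto p p = {1..p - 1}"
  proof (intro equalityI subsetI)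
    fix j assume "j \<in> units_upto p p"
    moreover from this have "j \<noteq> p" by (auto simp: units_upto_def)
    ultimately show "j \<in> {1..p - 1}" by (auto simp: units_upto_def)
  next
    fix j assume "j \<in> {1..p - 1}"
    then show "j \<in> units_upto p p" using p by (auto simp: units_upto_def dest: dvd_imp_le)
  qed
  have "of_nat (Suc ?n) * fps_nth ?y (Suc ?n) = fps_nth (fps_deriv ?y) ?n" by simp
  also have "\<dots> = - fps_nth ?y (p * m)"
    unfolding fps_deriv_dwork_twist[OF assms] by (simp add: fps_X_power_mult_nth)
  finally have y: "of_nat (Suc ?n) * fps_nth ?y (Suc ?n) = - fps_nth ?y (p * m)" .
  have f: "fact ?n = (fact (p * m) * (\<Prod>j\<in>units_upto p p. of_nat (p * m + j)) :: 'a)"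
  proof -
    have "pochhammer (1 + of_nat (p * m)) (p - 1) = (\<Prod>j = 0..<p - 1. 1 + of_nat (p * m) + of_nat j :: 'a)"
      by (rule pochhammer_prod)
    also have "\<dots> = (\<Prod>j\<in>{1..p - 1}. of_nat (p * m + j))"
      by (rule prod.reindex_bij_witness[of _ "\<lambda>j. j - 1" Suc]) auto
    finally show ?thesis
      using pochhammer_product'[of "1 :: 'a" "p * m" "p - 1"] unfolding pochhammer_fact U by simp
  qed
  have "dwork_eval p (p * Suc m) = (of_nat (Suc ?n) * fact ?n) * fps_nth ?y (Suc ?n)"
    unfolding dwork_eval_twist n by simp
  also have "\<dots> = - (fact ?n * fps_nth ?y (p * m))"
    using y by (simp only: mult.left_commute mult.commute[of "of_nat (Suc ?n)"] mult.assoc mult_minus_right)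
  also have "\<dots> = - (dwork_eval p (p * m) * (\<Prod>j\<in>units_upto p p. of_nat (p * m + j)))"
    unfolding dwork_eval_twist f by (simp add: mult_ac)
  also have "\<dots> = (-1) ^ Suc m * (\<Prod>j\<in>units_upto p (p * Suc m). of_nat j)"
  proof -
    have "(\<Prod>j\<in>units_upto p (p * Suc m). of_nat j :: 'a)
        = (\<Prod>j\<in>units_upto p (p * m). of_nat j) * (\<Prod>j\<in>units_upto p p. of_nat (p * m + j))"
      using prod_units_upto_add[of p "p * m" "of_nat :: nat \<Rightarrow> 'a" p] by (simp add: add.commute)
    then show ?thesis unfolding Suc.IH by (simp only: power_Suc) simp
  qed
  finally show ?case .
qed

section \<open>Taylor expansion of the interpolating series at 0\<close>

context padic_absval
begin

lemma D_inv_x_terms_dwork: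
  "D_inv_x_terms s (dwork_exp p :: 'a fps) k = fps_nth (dwork_exp p) k * of_nat (stirling k s)"
  by (simp add: D_inv_x_terms_def D_inv_x_monom_coeff0_stirling)

lemma decay_scaled:
  "decseq (\<lambda>k. real p ^ (s + 2) * decay k)" "(\<lambda>k. real p ^ (s + 2) * decay k) \<longlonglongrightarrow> 0"
  using decseq_decay tendsto_mult_right_zero[OF decay_tendsto]
  by (auto simp: decseq_def intro!: mult_left_mono)

lemma summable_dwork: "summable (D_inv_x_terms s (dwork_exp p :: 'a fps))"
  by (rule nonarch_summableI[OF _ decay_scaled[of s]]) (simp only: D_inv_x_terms_dwork dwork_stirling_bound)

abbreviation dwork_coeff :: "nat \<Rightarrow> 'a" where
  "dwork_coeff s \<equiv> D_inv_x_coeff0 s (dwork_exp p)"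

lemma dwork_coeff_tail:
  "absval (dwork_coeff s - (\<Sum>k<n. fps_nth (dwork_exp p) k * of_nat (stirling k s))) \<le> real p ^ (s + 2) * decay n"
proof -
  have "absval (D_inv_x_terms s (dwork_exp p :: 'a fps) k) \<le> real p ^ (s + 2) * decay k" for k
    by (simp only: D_inv_x_terms_dwork dwork_stirling_bound)
  from nonarch_suminf_tail[OF this decay_scaled] show ?thesis
    by (simp only: D_inv_x_coeff0_def D_inv_x_terms_dwork)
qed

lemma dwork_coeff_0: "dwork_coeff 0 = 1"
proof -
  have "dwork_coeff 0 = (\<Sum>k\<in>{0}. D_inv_x_terms 0 (dwork_exp p) k)"
    unfolding D_inv_x_coeff0_def
    by (rule suminf_finite) (simp_all add: D_inv_x_terms_dwork)
  then show ?thesis by (simp add: D_inv_x_terms_dwork)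
qed

lemma absval_le_inverse_p:
  assumes "p dvd n"
  shows "absval (of_nat n :: 'a) \<le> 1 / real p"
  using absval_of_int_power_dvd[of 1 "int n"] assms by simp

text \<open>Rising factorials are rewritten in powers of \<open>t\<close>. Truncation at a large
  \<open>K\<close> makes all sums finite, so that the order of summation can be exchanged.\<close>

lemma dwork_eval_expansion:
  assumes n: "p dvd n" "n > 0"
  shows "absval (dwork_eval p n - (\<Sum>s<4. dwork_coeff s * (- of_nat n) ^ s)) \<le> real p ^ 6 * absval (of_nat n :: 'a) ^ 4"
proof -
  define t where "t = (- of_nat n :: 'a)"
  define G where "G K s = (\<Sum>k<K. fps_nth (dwork_exp p) k * of_nat (stirling k s) :: 'a)" for K s
  have p3: "3 \<le> p" using p_ge_3[OF p] .
  have t0: "absval t > 0" using n(2) by (simp add: t_def)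
  have tp: "real p * absval t \<le> 1"
    using absval_le_inverse_p[OF n(1)] p3 by (simp add: t_def field_simps)
  have t1: "absval t \<le> 1" using absval_of_nat_le_1 by (simp add: t_def)
  have "\<forall>\<^sub>F K in sequentially. decay K < absval t ^ 4"
    using order_tendstoD(2)[OF decay_tendsto] t0 by simp
  \<comment> \<open>Beyond \<open>n\<close> the rising factorials at \<open>-n\<close> vanish, so
    truncation at \<open>K\<close> keeps the value exact; small \<open>decay K\<close> makes the
    truncated coefficients as good as \<open>dwork_coeff s\<close>.\<close>
  from eventually_conj[OF this eventually_ge_at_top[of "max 4 (Suc n)"]]
  obtain K where "decay K < absval t ^ 4 \<and> max 4 (Suc n) \<le> K"
    using eventually_happens'[OF sequentially_bot] by blast
  then have K: "decay K < absval t ^ 4" "4 \<le> K" "n < K" by auto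
  have "dwork_eval p n = (\<Sum>k<K. fps_nth (dwork_exp p) k * pochhammer t k)"
    unfolding dwork_eval_def t_def
    by (rule sum.mono_neutral_left) (use K(3) in \<open>auto simp: pochhammer_of_nat_eq_0_iff\<close>)
  also have "\<dots> = (\<Sum>k<K. \<Sum>s<K. fps_nth (dwork_exp p) k * of_nat (stirling k s) * t ^ s)"
  proof (rule sum.cong)
    fix k assume "k \<in> {..<K}"
    then have "(\<Sum>s\<le>k. of_nat (stirling k s) * t ^ s) = (\<Sum>s<K. of_nat (stirling k s) * t ^ s)"
      by (intro sum.mono_neutral_left) auto
    then show "fps_nth (dwork_exp p) k * pochhammer t k
        = (\<Sum>s<K. fps_nth (dwork_exp p) k * of_nat (stirling k s) * t ^ s)"
      by (simp add: sum_distrib_left mult.assoc flip: stirling_pochhammer)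
  qed simp
  also have "\<dots> = (\<Sum>s<K. G K s * t ^ s)"
    by (subst sum.swap) (simp add: G_def sum_distrib_right)
  also have "\<dots> = (\<Sum>s<4. G K s * t ^ s) + (\<Sum>s\<in>{4..<K}. G K s * t ^ s)"
    using K(2) by (metis sum.atLeastLessThan_concat lessThan_atLeast0 le0)
  finally have "dwork_eval p n - (\<Sum>s<4. dwork_coeff s * t ^ s)
      = (\<Sum>s\<in>{4..<K}. G K s * t ^ s) - (\<Sum>s<4. (dwork_coeff s - G K s) * t ^ s)"
    by (simp add: sum_subtractf left_diff_distrib)
  moreover have "absval (\<Sum>s\<in>{4..<K}. G K s * t ^ s) \<le> real p ^ 6 * absval t ^ 4"
  proof (rule absval_sum_le)
    fix s assume s: "s \<in> {4..<K}"
    have "absval (G K s) \<le> real p ^ (s + 2)"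
      unfolding G_def
    proof (rule absval_sum_le)
      fix k
      have "real p ^ (s + 2) * decay k \<le> real p ^ (s + 2)"
        by (rule mult_left_le[OF decay_le_1]) simp
      with dwork_stirling_bound[of k s]
      show "absval (fps_nth (dwork_exp p) k * of_nat (stirling k s) :: 'a) \<le> real p ^ (s + 2)"
        by linarith
    qed simp
    then have "absval (G K s * t ^ s) \<le> real p ^ (s + 2) * absval t ^ s"
      by (simp add: absval_mult absval_power mult_right_mono)
    \<comment> \<open>As \<open>p\<close> divides \<open>n\<close>, \<open>real p * absval t\<close>
      is at most 1, which absorbs the growth p^s of the coefficient bound; \<open>s = 4\<close> is
      the worst case and gives p^6.\<close>
    also have "\<dots> = real p ^ 2 * (real p * absval t) ^ s"
      by (simp add: power_add power_mult_distrib power2_eq_square)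
    also have "\<dots> \<le> real p ^ 2 * (real p * absval t) ^ 4"
      using s tp by (intro mult_left_mono power_decreasing) auto
    also have "\<dots> = real p ^ 6 * absval t ^ 4"
      by (simp add: power_mult_distrib flip: power_add)
    finally show "absval (G K s * t ^ s) \<le> real p ^ 6 * absval t ^ 4" .
  qed simp
  moreover have "absval (\<Sum>s<4. (dwork_coeff s - G K s) * t ^ s) \<le> real p ^ 6 * absval t ^ 4"
  proof (rule absval_sum_le)
    fix s :: nat assume s: "s \<in> {..<4}"
    have "absval ((dwork_coeff s - G K s) * t ^ s) \<le> absval (dwork_coeff s - G K s)"
      using t1 by (simp add: absval_mult absval_power mult_left_le power_le_one)
    also have "\<dots> \<le> real p ^ (s + 2) * decay K"
      unfolding G_def by (rule dwork_coeff_tail)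
    also have "\<dots> \<le> real p ^ 6 * absval t ^ 4"
      using s K(1) p3 by (intro mult_mono power_increasing) (auto simp: decay_nonneg)
    finally show "absval ((dwork_coeff s - G K s) * t ^ s) \<le> real p ^ 6 * absval t ^ 4" .
  qed simp
  ultimately show ?thesis
    using absval_diff_le by (simp add: t_def)
qed

end

section \<open>Asymptotics along powers of \<open>p\<close>\<close>

text \<open>The first estimate is carried along because the cross term \<open>z x * (P - 1)\<close>
  in the inductive step of the second one needs it.\<close>

lemma prod_one_plus_approx:
  fixes z :: "'b \<Rightarrow> 'a::nonarch_field"
  assumes "finite A" "\<And>j. j \<in> A \<Longrightarrow> absval (z j) \<le> e" "0 \<le> e" "e \<le> 1"
  shows "absval ((\<Prod>j\<in>A. 1 + z j) - 1) \<le> e \<and> absval ((\<Prod>j\<in>A. 1 + z j) - 1 - (\<Sum>j\<in>A. z j)) \<le> e\<^sup>2"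
  using assms(1,2)
proof (induction A rule: finite_induct)
  case (insert x A)
  define P S where "P = (\<Prod>j\<in>A. 1 + z j)" and "S = (\<Sum>j\<in>A. z j)"
  have IH: "absval (P - 1) \<le> e" "absval (P - 1 - S) \<le> e\<^sup>2" and x: "absval (z x) \<le> e"
    using insert by (auto simp: P_def S_def)
  have zP: "absval (z x * (P - 1)) \<le> e\<^sup>2"
    using mult_mono[OF x IH(1)] assms(3) by (simp add: absval_mult power2_eq_square)
  also have "e\<^sup>2 \<le> e" using assms(3,4) by (simp add: power2_eq_square mult_left_le)
  finally have "absval ((P - 1) + (z x + z x * (P - 1))) \<le> e"
    using IH(1) x by (intro absval_add_le)
  moreover have "absval ((P - 1 - S) + z x * (P - 1)) \<le> e\<^sup>2"
    by (rule absval_add_le[OF IH(2) zP])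
  moreover have "(\<Prod>j\<in>insert x A. 1 + z j) = (1 + z x) * P" "(\<Sum>j\<in>insert x A. z j) = z x + S"
    using insert.hyps by (simp_all add: P_def S_def)
  ultimately show ?case by (simp add: algebra_simps)
qed (use assms(3) in simp)

section \<open>Calculus of O(N^r) and of cubic expansions in N\<close>

context padic_absval
begin

lemma absval_unit: "j \<in> units_upto p n \<Longrightarrow> absval (of_nat j :: 'a) = 1"
  by (simp add: units_upto_def absval_of_nat_unit)

definition pw :: "nat \<Rightarrow> 'a" where
  "pw k = of_nat (p ^ (k + 1))"

lemma absval_pw: "absval (pw k) = (1 / real p) ^ (k + 1)"
  by (simp add: pw_def absval_mult absval_power absval_p)

lemma absval_pw_le_1: "absval (pw k) \<le> 1"
  unfolding pw_def by (rule absval_of_nat_le_1)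

lemma pw_nonzero: "pw k \<noteq> 0"
  using p_ge_3[OF p] by (simp add: pw_def)

text \<open>\<open>x\<^sub>k = O(N\<^sup>r)\<close> for \<open>N = p^(k+1)\<close>.\<close>

definition vanish :: "nat \<Rightarrow> (nat \<Rightarrow> 'a) \<Rightarrow> bool" where
  "vanish r x \<longleftrightarrow> (\<exists>C. \<forall>k. absval (x k) \<le> C * absval (pw k) ^ r)"

lemma vanishI: "(\<And>k. absval (x k) \<le> C * absval (pw k) ^ r) \<Longrightarrow> vanish r x"
  unfolding vanish_def by blast

lemma vanishE:
  assumes "vanish r x"
  obtains C where "C \<ge> 0" "\<forall>k. absval (x k) \<le> C * absval (pw k) ^ r"
proof -
  from assms obtain C where C: "\<And>k. absval (x k) \<le> C * absval (pw k) ^ r"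
    by (auto simp: vanish_def)
  have "0 \<le> C * absval (pw 0) ^ r" using C[of 0] absval_nonneg order_trans by blast
  moreover have "absval (pw 0) ^ r > 0" by (simp add: pw_nonzero)
  ultimately have "C \<ge> 0" by (simp add: zero_le_mult_iff)
  with C that show thesis by blast
qed

lemma vanish_add:
  assumes "vanish r x" "vanish r y"
  shows "vanish r (\<lambda>k. x k + y k)"
proof -
  from vanishE[OF assms(1)] obtain C where
    "C \<ge> 0" "\<forall>k. absval (x k) \<le> C * absval (pw k) ^ r" .
  note C = this(1) this(2)[rule_format]
  from vanishE[OF assms(2)] obtain D where
    "D \<ge> 0" "\<forall>k. absval (y k) \<le> D * absval (pw k) ^ r" .
  note D = this(1) this(2)[rule_format]
  show ?thesis
  proof (rule vanishI[of _ "max C D"])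
    fix k
    have "C * absval (pw k) ^ r \<le> max C D * absval (pw k) ^ r"
      "D * absval (pw k) ^ r \<le> max C D * absval (pw k) ^ r"
      by (intro mult_right_mono; simp)+
    then show "absval (x k + y k) \<le> max C D * absval (pw k) ^ r"
      using C(2)[of k] D(2)[of k] by (intro absval_add_le) linarith+
  qed
qed

lemma vanish_mult:
  assumes "vanish r x" "vanish s y"
  shows "vanish (r + s) (\<lambda>k. x k * y k)"
proof -
  from vanishE[OF assms(1)] obtain C where
    "C \<ge> 0" "\<forall>k. absval (x k) \<le> C * absval (pw k) ^ r" .
  note C = this(1) this(2)[rule_format]
  from vanishE[OF assms(2)] obtain D where
    "D \<ge> 0" "\<forall>k. absval (y k) \<le> D * absval (pw k) ^ s" .
  note D = this(1) this(2)[rule_format]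
  show ?thesis
  proof (rule vanishI[of _ "C * D"])
    fix k
    have "absval (x k) * absval (y k) \<le> (C * absval (pw k) ^ r) * (D * absval (pw k) ^ s)"
      using C D by (intro mult_mono) auto
    then show "absval (x k * y k) \<le> C * D * absval (pw k) ^ (r + s)"
      by (simp only: absval_mult power_add mult_ac)
  qed
qed

lemma vanish_const: "vanish 0 (\<lambda>k. c)"
  by (rule vanishI[of _ "absval c"]) simp

lemma vanish_pw: "vanish 1 pw"
  by (rule vanishI[of _ 1]) simp

lemma vanish_pw_power: "vanish r (\<lambda>k. pw k ^ r)"
  by (rule vanishI[of _ 1]) (simp only: absval_power mult_1_left order_refl)

lemma vanish_minus: "vanish r x \<Longrightarrow> vanish r (\<lambda>k. - x k)"
  by (simp add: vanish_def)

lemma vanish_diff: "vanish r x \<Longrightarrow> vanish r y \<Longrightarrow> vanish r (\<lambda>k. x k - y k)"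
  using vanish_add[OF _ vanish_minus] by fastforce

lemma vanish_mono:
  assumes "vanish s x" "r \<le> s"
  shows "vanish r x"
proof -
  from vanishE[OF assms(1)] obtain C where
    "C \<ge> 0" "\<forall>k. absval (x k) \<le> C * absval (pw k) ^ s" .
  note C = this(1) this(2)[rule_format]
  show ?thesis
  proof (rule vanishI[of _ C])
    fix k
    have "C * absval (pw k) ^ s \<le> C * absval (pw k) ^ r"
      using C(1) assms(2) absval_pw_le_1 by (intro mult_left_mono power_decreasing) auto
    then show "absval (x k) \<le> C * absval (pw k) ^ r" using C(2)[of k] by linarith
  qed
qed

lemma vanish_cancel:
  assumes "vanish (r + s) (\<lambda>k. pw k ^ r * x k)"
  shows "vanish s x"
proof -
  from vanishE[OF assms] obtain C where
    "C \<ge> 0" "\<forall>k. absval (pw k ^ r * x k) \<le> C * absval (pw k) ^ (r + s)" .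
  note C = this(1) this(2)[rule_format]
  show ?thesis
  proof (rule vanishI[of _ C])
    fix k
    have "absval (pw k) ^ r * absval (x k) \<le> absval (pw k) ^ r * (C * absval (pw k) ^ s)"
      using C(2)[of k] by (simp only: absval_mult absval_power power_add mult_ac)
    moreover have "absval (pw k) ^ r > 0" by (simp add: pw_nonzero)
    ultimately show "absval (x k) \<le> C * absval (pw k) ^ s"
      using mult_le_cancel_left_pos by blast
  qed
qed

lemma absval_pw_tendsto: "(\<lambda>k. absval (pw k)) \<longlonglongrightarrow> 0"
proof -
  have "(\<lambda>k. (1 / real p) ^ k) \<longlonglongrightarrow> 0"
    using p_ge_3[OF p] by (intro LIMSEQ_power_zero) simp
  then show ?thesis unfolding absval_pw Suc_eq_plus1[symmetric] by (rule LIMSEQ_Suc)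
qed

lemma vanish_tendsto:
  assumes "vanish 1 (\<lambda>k. x k - L)"
  shows "x \<longlonglongrightarrow> L"
proof -
  from vanishE[OF assms] obtain C where
    "C \<ge> 0" "\<forall>k. absval (x k - L) \<le> C * absval (pw k) ^ 1" .
  note C = this(1) this(2)[rule_format]
  have "(\<lambda>k. dist (x k) L) \<longlonglongrightarrow> 0"
  proof (rule tendsto_sandwich[of "\<lambda>_. 0" _ _ "\<lambda>k. C * absval (pw k)"])
    show "(\<lambda>k. C * absval (pw k)) \<longlonglongrightarrow> 0"
      using tendsto_mult_right_zero[OF absval_pw_tendsto] .
    show "\<forall>\<^sub>F k in sequentially. dist (x k) L \<le> C * absval (pw k)"
      using C by (simp add: dist_absval)
  qed simp_all
  then show ?thesis by (rule tendsto_dist_iff[THEN iffD2])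
qed

lemma vanish_const_zero:
  assumes "vanish 1 (\<lambda>k. c)"
  shows "c = 0"
proof -
  have "(\<lambda>k. c) \<longlonglongrightarrow> 0" using assms by (intro vanish_tendsto) simp
  then show ?thesis by (simp add: LIMSEQ_const_iff)
qed

text \<open>Precision O(N^4) suffices: the comparison below divides by N^2 and then by N, leaving
  O(N) for convergence.\<close>

definition cubic :: "'a \<Rightarrow> 'a \<Rightarrow> 'a \<Rightarrow> (nat \<Rightarrow> 'a) \<Rightarrow> bool" where
  "cubic u v w x \<longleftrightarrow> vanish 4 (\<lambda>k. x k - (1 + u * pw k + v * pw k ^ 2 + w * pw k ^ 3))"

lemma cubic_mult:
  assumes "cubic u v w x" "cubic u' v' w' x'"
  shows "cubic (u + u') (v + v' + u * u') (w + w' + u * v' + v * u') (\<lambda>k. x k * x' k)"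
proof -
  define T where "T k = 1 + u * pw k + v * pw k ^ 2 + w * pw k ^ 3" for k
  define T' where "T' k = 1 + u' * pw k + v' * pw k ^ 2 + w' * pw k ^ 3" for k
  \<comment> \<open>The terms of degree 4 to 6 of \<open>T k * T' k\<close>, divided by N^4.\<close>
  define R where "R k = (u * w' + v * v' + w * u') + (v * w' + w * v') * pw k + w * w' * pw k ^ 2" for k
  have d: "vanish 4 (\<lambda>k. x k - T k)" "vanish 4 (\<lambda>k. x' k - T' k)"
    using assms by (simp_all only: cubic_def T_def T'_def)
  have 0: "vanish 0 (\<lambda>k. pw k ^ r)" for r by (rule vanish_mono[OF vanish_pw_power]) simp
  have m: "vanish 0 (\<lambda>k. c * y k)" if "vanish 0 y" for c y
    using vanish_mult[OF vanish_const[of c] that] by simp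
  have pw0: "vanish 0 pw" using 0[of 1] by (simp only: power_one_right)
  have T0: "vanish 0 T" "vanish 0 T'" "vanish 0 R"
    unfolding T_def T'_def R_def by (intro vanish_add vanish_const m 0 pw0)+
  have "vanish 4 (\<lambda>k. (x k - T k) * (x' k - T' k))"
    by (rule vanish_mono[OF vanish_mult[OF d]]) simp
  moreover have "vanish 4 (\<lambda>k. (x k - T k) * T' k)" "vanish 4 (\<lambda>k. T k * (x' k - T' k))"
    "vanish 4 (\<lambda>k. pw k ^ 4 * R k)"
    using vanish_mult[OF d(1) T0(2)] vanish_mult[OF T0(1) d(2)] vanish_mult[OF vanish_pw_power[of 4] T0(3)]
    by simp_all
  ultimately have "vanish 4 (\<lambda>k. ((x k - T k) * (x' k - T' k) + (x k - T k) * T' k)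
      + (T k * (x' k - T' k) + pw k ^ 4 * R k))"
    by (intro vanish_add)
  moreover have "(\<lambda>k. ((x k - T k) * (x' k - T' k) + (x k - T k) * T' k)
      + (T k * (x' k - T' k) + pw k ^ 4 * R k)) =
    (\<lambda>k. x k * x' k - (1 + (u + u') * pw k + (v + v' + u * u') * pw k ^ 2
      + (w + w' + u * v' + v * u') * pw k ^ 3))"
  proof
    fix k
    have *: "(a - t) * (a' - t') + (a - t) * t' + (t * (a' - t') + e) = a * a' - (t * t' - e)" for a t a' t' e :: 'a
      by (simp add: algebra_simps)
    have "T k * T' k - pw k ^ 4 * R k = 1 + (u + u') * pw k + (v + v' + u * u') * pw k ^ 2
      + (w + w' + u * v' + v * u') * pw k ^ 3"
      unfolding T_def T'_def R_def by (simp add: algebra_simps eval_nat_numeral)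
    then show "((x k - T k) * (x' k - T' k) + (x k - T k) * T' k) + (T k * (x' k - T' k) + pw k ^ 4 * R k)
      = x k * x' k - (1 + (u + u') * pw k + (v + v' + u * u') * pw k ^ 2
      + (w + w' + u * v' + v * u') * pw k ^ 3)"
      unfolding * by simp
  qed
  ultimately show ?thesis by (simp only: cubic_def)
qed

lemma dwork_eval_cubic:
  assumes "\<not> p dvd c" "c > 0"
  shows "cubic (- of_nat c * dwork_coeff 1) (of_nat c ^ 2 * dwork_coeff 2) (- (of_nat c ^ 3) * dwork_coeff 3)
    (\<lambda>k. dwork_eval p (c * p ^ (k + 1)))"
  unfolding cubic_def
proof (rule vanishI[of _ "real p ^ 6"])
  fix k
  let ?n = "c * p ^ (k + 1)"
  have "(\<Sum>s<4. dwork_coeff s * (- of_nat ?n) ^ s) = 1 + - of_nat c * dwork_coeff 1 * pw k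
      + of_nat c ^ 2 * dwork_coeff 2 * pw k ^ 2 + - (of_nat c ^ 3) * dwork_coeff 3 * pw k ^ 3"
    by (simp only: of_nat_mult pw_def[symmetric])
       (simp add: eval_nat_numeral dwork_coeff_0 algebra_simps)
  moreover have "absval (of_nat ?n :: 'a) = absval (pw k)"
    by (simp only: of_nat_mult pw_def[symmetric] absval_mult absval_of_nat_unit[OF assms(1)] mult_1_left)
  ultimately show "absval (dwork_eval p ?n - (1 + - of_nat c * dwork_coeff 1 * pw k
      + of_nat c ^ 2 * dwork_coeff 2 * pw k ^ 2 + - (of_nat c ^ 3) * dwork_coeff 3 * pw k ^ 3))
      \<le> real p ^ 6 * absval (pw k) ^ 4"
    using dwork_eval_expansion[of ?n] assms(2) p_ge_3[OF p] by simp
qed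

section \<open>Inverse-square sums and products over units\<close>

definition inv_sq_sum :: "nat \<Rightarrow> 'a" where
  "inv_sq_sum n = (\<Sum>j\<in>units_upto p n. 1 / of_nat j ^ 2)"

lemma sum_units_upto_multiple:
  assumes "p dvd n"
  shows "sum g (units_upto p (c * n)) = (\<Sum>a<c. \<Sum>j\<in>units_upto p n. g (a * n + j))"
proof (induction c)
  case 0
  have "units_upto p 0 = {}" by (auto simp: units_upto_def)
  then show ?case by simp
next
  case (Suc c)
  then show ?case
    using sum_units_upto_add[of p "c * n" g n] assms by (simp add: add.commute)
qed

text \<open>The units up to \<open>p * n\<close> are \<open>p\<close> translates of those up to
  \<open>n\<close>, and a shift by \<open>a * n\<close> changes an inverse square only by O(n).
  Hence the sum is \<open>p\<close> times the old one up to O(n).\<close>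

lemma inv_sq_sum_multiple:
  assumes "p dvd n"
  shows "absval (inv_sq_sum (p * n)) \<le> max (absval (inv_sq_sum n) / real p) (absval (of_nat n :: 'a))"
proof -
  let ?U = "units_upto p n"
  have "inv_sq_sum (p * n) - of_nat p * inv_sq_sum n
      = (\<Sum>a<p. \<Sum>j\<in>?U. 1 / of_nat (a * n + j) ^ 2 - 1 / of_nat j ^ 2)"
    unfolding inv_sq_sum_def sum_units_upto_multiple[OF assms] by (simp add: sum_subtractf)
  moreover have "absval (\<Sum>a<p. \<Sum>j\<in>?U. 1 / of_nat (a * n + j) ^ 2 - 1 / of_nat j ^ 2 :: 'a) \<le> absval (of_nat n :: 'a)"
  proof (intro absval_sum_le absval_nonneg)
    fix a j assume j: "j \<in> ?U"
    define x y where "x = (of_nat (a * n + j) :: 'a)" and "y = (of_nat j :: 'a)"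
    have "\<not> p dvd a * n + j" using j assms by (simp add: units_upto_def dvd_add_right_iff)
    then have xy: "absval x = 1" "absval y = 1"
      using j by (simp_all add: x_def y_def absval_unit absval_of_nat_unit del: of_nat_add)
    then have "x \<noteq> 0" "y \<noteq> 0" by auto
    then have "1 / x ^ 2 - 1 / y ^ 2 = - ((x - y) * (x + y)) / (x ^ 2 * y ^ 2)"
      by (simp add: field_simps power2_eq_square)
    also have "x - y = of_nat a * of_nat n" by (simp add: x_def y_def)
    finally have "absval (1 / x ^ 2 - 1 / y ^ 2) = absval (of_nat a :: 'a) * absval (of_nat n :: 'a) * absval (x + y)"
      using xy by (simp add: absval_divide absval_mult absval_power)
    also have "\<dots> \<le> 1 * absval (of_nat n :: 'a) * 1"
      using absval_of_nat_le_1 xy by (intro mult_mono absval_add_le) auto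
    finally show "absval (1 / of_nat (a * n + j) ^ 2 - 1 / of_nat j ^ 2 :: 'a) \<le> absval (of_nat n :: 'a)"
      by (simp add: x_def y_def)
  qed
  ultimately have "absval (inv_sq_sum (p * n) - of_nat p * inv_sq_sum n) \<le> absval (of_nat n :: 'a)" by simp
  moreover have "absval (of_nat p * inv_sq_sum n) = absval (inv_sq_sum n) / real p"
    by (simp add: absval_mult absval_p)
  ultimately show ?thesis
    using absval_add[of "inv_sq_sum (p * n) - of_nat p * inv_sq_sum n" "of_nat p * inv_sq_sum n"] by simp
qed

text \<open>An a priori bound, obtained before any limit is known. The constant \<open>p\<close>
  appears because the induction starts with a sum over units up to \<open>p\<close> that is only
  known to be integral.\<close>

lemma vanish_inv_sq_sum: "vanish 1 (\<lambda>k. inv_sq_sum (p ^ (k + 1)))"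
proof (rule vanishI[of _ "real p"])
  fix k
  have p3: "3 \<le> p" using p_ge_3[OF p] .
  have "absval (inv_sq_sum (p ^ (k + 1))) \<le> (1 / real p) ^ k"
  proof (induction k)
    case 0
    have "absval (1 / of_nat j ^ 2 :: 'a) \<le> 1" if "j \<in> units_upto p p" for j
      by (simp add: absval_divide absval_power absval_unit[OF that])
    then show ?case by (simp add: inv_sq_sum_def absval_sum_le)
  next
    case (Suc k)
    have "absval (of_nat (p ^ (k + 1)) :: 'a) = (1 / real p) ^ Suc k"
      using absval_pw[of k] by (simp only: pw_def Suc_eq_plus1)
    moreover have "absval (inv_sq_sum (p ^ (k + 1))) / real p \<le> (1 / real p) ^ Suc k"
      using Suc.IH p3 by (simp add: divide_right_mono)
    ultimately have "absval (inv_sq_sum (p * p ^ (k + 1))) \<le> (1 / real p) ^ Suc k"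
      using inv_sq_sum_multiple[of "p ^ (k + 1)"] by (simp add: max_def split: if_splits)
    then show ?case by simp
  qed
  also have "\<dots> = real p * absval (pw k) ^ 1"
    using p3 by (simp add: absval_pw)
  finally show "absval (inv_sq_sum (p ^ (k + 1))) \<le> real p * absval (pw k) ^ 1" .
qed

text \<open>The units up to \<open>2 * n\<close> are the \<open>j\<close> and the
  \<open>n + j\<close> with \<open>j\<close> a unit up to \<open>n\<close>, and n + j = j (1 + n/j).
  The signs are an even power of -1 on the left and a square on the right.\<close>

lemma dwork_eval_double:
  assumes n: "p dvd n" "odd n"
  shows "dwork_eval p (2 * n) = (dwork_eval p n)\<^sup>2 * (\<Prod>j\<in>units_upto p n. 1 + of_nat n / of_nat j :: 'a)"
proof -
  obtain m where m: "n = p * m" using n(1) by auto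
  then have "odd m" using n(2) by simp
  let ?U = "units_upto p n"
  have "dwork_eval p (2 * n) = (\<Prod>j\<in>units_upto p (n + n). of_nat j :: 'a)"
    using dwork_eval_multiple[OF p(2), of "2 * m", where 'a = 'a] by (simp add: m mult_2 distrib_left)
  also have "\<dots> = (\<Prod>j\<in>?U. of_nat j) * (\<Prod>j\<in>?U. of_nat (n + j))"
    by (rule prod_units_upto_add[OF n(1)])
  also have "(\<Prod>j\<in>?U. of_nat (n + j) :: 'a) = (\<Prod>j\<in>?U. of_nat j * (1 + of_nat n / of_nat j))"
    by (rule prod.cong) (auto simp: units_upto_def field_simps)
  finally show ?thesis
    using dwork_eval_multiple[OF p(2), of m, where 'a = 'a] \<open>odd m\<close>
    by (simp add: m power2_eq_square prod.distrib)
qed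

text \<open>Squaring provides a second copy of the product in which \<open>j\<close> can be
  reflected to \<open>n - j\<close>; the terms linear in \<open>n\<close> then merge into quadratic
  ones.\<close>

lemma prod_units_squared:
  assumes n: "p dvd n"
  shows "absval ((\<Prod>j\<in>units_upto p n. 1 + of_nat n / of_nat j)\<^sup>2 - (1 - 2 * (of_nat n)\<^sup>2 * inv_sq_sum n))
    \<le> absval (of_nat n :: 'a) ^ 4"
proof -
  let ?U = "units_upto p n" and ?n = "of_nat n :: 'a"
  define u where "u j = (of_nat j :: 'a)" for j
  define z where "z j = 2 * ?n ^ 2 / (u j * u (n - j))" for j
  have refl: "n - j \<in> ?U" if "j \<in> ?U" for j
    using bij_betwE[OF units_upto_reflect[OF n]] that by blast
  have u1: "absval (u j) = 1" "absval (u (n - j)) = 1" if "j \<in> ?U" for j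
    using that refl[OF that] by (simp_all add: u_def absval_unit)
  have un: "u j \<noteq> 0" "u (n - j) \<noteq> 0" "u j + u (n - j) = ?n" if "j \<in> ?U" for j
    using u1[OF that] that by (auto simp: u_def units_upto_def simp flip: of_nat_add)
  have swap: "(\<Prod>j\<in>?U. g (n - j)) = prod g ?U" "(\<Sum>j\<in>?U. h (n - j)) = sum h ?U" for g h :: "nat \<Rightarrow> 'a"
    by (rule prod.reindex_bij_betw[OF units_upto_reflect[OF n]], rule sum.reindex_bij_betw[OF units_upto_reflect[OF n]])
  have "(\<Prod>j\<in>?U. 1 + ?n / u j)\<^sup>2 = (\<Prod>j\<in>?U. (1 + ?n / u j) * (1 + ?n / u (n - j)))"
    unfolding power2_eq_square prod.distrib swap(1)[of "\<lambda>j. 1 + ?n / u j"] ..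
  also have "\<dots> = (\<Prod>j\<in>?U. 1 + z j)"
  proof (rule prod.cong)
    fix j assume j: "j \<in> ?U"
    have "(1 + s / x) * (1 + s / y) = 1 + 2 * s ^ 2 / (x * y)" if "x \<noteq> 0" "y \<noteq> 0" "x + y = s" for x y s :: 'a
      unfolding that(3)[symmetric] using that(1,2) by (simp add: field_simps power2_eq_square)
    from this[OF un[OF j]] show "(1 + ?n / u j) * (1 + ?n / u (n - j)) = 1 + z j"
      by (simp only: z_def)
  qed simp
  finally have P: "(\<Prod>j\<in>?U. 1 + ?n / u j)\<^sup>2 = (\<Prod>j\<in>?U. 1 + z j)" .
  have n1: "absval ?n \<le> 1" "absval (2 :: 'a) \<le> 1"
    using absval_of_nat_le_1[of n, where 'a = 'a] absval_of_nat_le_1[of 2, where 'a = 'a] by simp_all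
  have "absval ((\<Prod>j\<in>?U. 1 + z j) - 1 - (\<Sum>j\<in>?U. z j)) \<le> (absval ?n ^ 2)\<^sup>2"
  proof (rule prod_one_plus_approx[THEN conjunct2])
    fix j assume "j \<in> ?U"
    then show "absval (z j) \<le> absval ?n ^ 2"
      using n1(2) by (simp add: z_def absval_divide absval_mult absval_power u1 mult_left_le_one_le)
  qed (use n1 in \<open>simp_all add: power_le_one\<close>)
  moreover have "(\<Sum>j\<in>?U. z j) = - 2 * ?n\<^sup>2 * inv_sq_sum n + ?n ^ 4 * (\<Sum>j\<in>?U. 1 / (u j * u (n - j))\<^sup>2)"
  proof -
    have "(\<Sum>j\<in>?U. z j) = (\<Sum>j\<in>?U. ?n ^ 4 * (1 / (u j * u (n - j))\<^sup>2)
        - ?n\<^sup>2 * (1 / u j ^ 2) - ?n\<^sup>2 * (1 / u (n - j) ^ 2))"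
    proof (rule sum.cong)
      fix j assume j: "j \<in> ?U"
      \<comment> \<open>Expanding s^2 = (x + y)^2 trades the mixed term 1/(xy) for inverse squares,
        up to a term of order s^4.\<close>
      have "2 * s ^ 2 / (x * y) = s ^ 4 * (1 / (x * y)\<^sup>2) - s\<^sup>2 * (1 / x ^ 2) - s\<^sup>2 * (1 / y ^ 2)"
        if "x \<noteq> 0" "y \<noteq> 0" "x + y = s" for x y s :: 'a
        unfolding that(3)[symmetric] using that(1,2) by (simp add: field_simps eval_nat_numeral)
      from this[OF un[OF j]] show "z j = ?n ^ 4 * (1 / (u j * u (n - j))\<^sup>2)
        - ?n\<^sup>2 * (1 / u j ^ 2) - ?n\<^sup>2 * (1 / u (n - j) ^ 2)"
        by (simp only: z_def)
    qed simp
    also have "\<dots> = ?n ^ 4 * (\<Sum>j\<in>?U. 1 / (u j * u (n - j))\<^sup>2)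
        - ?n\<^sup>2 * (\<Sum>j\<in>?U. 1 / u j ^ 2) - ?n\<^sup>2 * (\<Sum>j\<in>?U. 1 / u (n - j) ^ 2)"
      by (simp only: sum_subtractf sum_distrib_left)
    also have "(\<Sum>j\<in>?U. 1 / u (n - j) ^ 2) = (\<Sum>j\<in>?U. 1 / u j ^ 2)"
      by (rule swap(2))
    also have "(\<Sum>j\<in>?U. 1 / u j ^ 2) = inv_sq_sum n"
      by (simp only: inv_sq_sum_def u_def)
    finally show ?thesis by simp
  qed
  moreover have "absval (?n ^ 4 * (\<Sum>j\<in>?U. 1 / (u j * u (n - j))\<^sup>2)) \<le> absval ?n ^ 4"
  proof -
    have "absval (\<Sum>j\<in>?U. 1 / (u j * u (n - j))\<^sup>2) \<le> 1"
      by (rule absval_sum_le) (simp_all add: absval_divide absval_mult absval_power u1)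
    then show ?thesis by (simp add: absval_mult absval_power mult_left_le)
  qed
  ultimately have "absval (((\<Prod>j\<in>?U. 1 + ?n / u j)\<^sup>2 - 1 - (\<Sum>j\<in>?U. z j))
      + ?n ^ 4 * (\<Sum>j\<in>?U. 1 / (u j * u (n - j))\<^sup>2)) \<le> absval ?n ^ 4"
    unfolding P by (intro absval_add_le) (simp_all flip: power_mult)
  then show ?thesis
    using \<open>(\<Sum>j\<in>?U. z j) = _\<close> by (simp add: u_def algebra_simps)
qed

section \<open>Comparison of expansions and the limit\<close>

lemma kubota_leopoldt_seq_3: "kubota_leopoldt_seq p 3 k = inv_sq_sum (p ^ (k + 1)) / pw k"
  by (simp add: kubota_leopoldt_seq_def inv_sq_sum_def units_upto_def pw_def)

text \<open>Both sides of G(-2N)^2 = G(-N)^4 \<open>P\<close> are expanded up to O(N^4). The linear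
  coefficients agree, so N^2 can be cancelled.\<close>

lemma inv_sq_sum_expansion:
  "vanish 2 (\<lambda>k. (4 * dwork_coeff 2 - 2 * dwork_coeff 1 ^ 2)
      - (12 * dwork_coeff 3 + 4 * dwork_coeff 1 * dwork_coeff 2 - 4 * dwork_coeff 1 ^ 3) * pw k
      + 2 * inv_sq_sum (p ^ (k + 1)))"
proof -
  define N where "N k = p ^ (k + 1)" for k
  define a where "a k = (dwork_eval p (N k) :: 'a)" for k
  define b where "b k = (dwork_eval p (2 * N k) :: 'a)" for k
  define S where "S k = inv_sq_sum (N k)" for k
  define P where "P k = (\<Prod>j\<in>units_upto p (N k). 1 + of_nat (N k) / of_nat j :: 'a)\<^sup>2" for k
  define g1 g2 g3 where "g1 = dwork_coeff 1" and "g2 = dwork_coeff 2" and "g3 = dwork_coeff 3"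
  have p3: "3 \<le> p" using p_ge_3[OF p] .
  have N: "p dvd N k" "odd (N k)" for k using p(2) by (simp_all add: N_def)
  have pwN: "pw k = of_nat (N k)" for k by (simp only: pw_def N_def)
  have a: "cubic (- g1) g2 (- g3) a"
    using dwork_eval_cubic[of 1] p3 by (simp add: a_def[abs_def] N_def g1_def g2_def g3_def)
  have "\<not> p dvd 2" using p3 by (auto dest: dvd_imp_le)
  then have b: "cubic (- 2 * g1) (4 * g2) (- 8 * g3) b"
    using dwork_eval_cubic[of 2] by (simp add: b_def[abs_def] N_def g1_def g2_def g3_def)
  note a4 = cubic_mult[OF cubic_mult[OF a a] cubic_mult[OF a a]] and b2 = cubic_mult[OF b b]
  have ab: "b k * b k = (a k * a k * (a k * a k)) * P k" for k
    unfolding b_def dwork_eval_double[OF N] by (simp add: a_def P_def power2_eq_square mult_ac)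
  have P: "vanish 4 (\<lambda>k. P k - (1 - 2 * pw k ^ 2 * S k))"
    using prod_units_squared[OF N(1)]
    by (intro vanishI[of _ 1]) (simp only: P_def S_def pwN mult_1_left)
  have S: "vanish 1 S" using vanish_inv_sq_sum by (simp only: S_def[abs_def] N_def)
  have pS: "vanish 3 (\<lambda>k. 2 * pw k ^ 2 * S k)"
    using vanish_mult[OF vanish_mult[OF vanish_const[of 2] vanish_pw_power[of 2]] S] by (simp add: numeral_3_eq_3)
  \<comment> \<open>Coefficients of G(-N)^4; \<open>d2\<close> and \<open>d3\<close> are those of
    G(-2N)^2, whose linear coefficient is also \<open>c1\<close>.\<close>
  define c1 c2 c3 where "c1 = - 4 * g1" and "c2 = 4 * g2 + 6 * g1 ^ 2"
    and "c3 = - 12 * g1 * g2 - 4 * g3 - 4 * g1 ^ 3"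
  define d2 d3 where "d2 = 8 * g2 + 4 * g1 ^ 2" and "d3 = - 16 * g3 - 16 * g1 * g2"
  have A: "cubic c1 c2 c3 (\<lambda>k. a k * a k * (a k * a k))"
    using a4 by (simp add: c1_def c2_def c3_def algebra_simps eval_nat_numeral)
  have B: "cubic c1 d2 d3 (\<lambda>k. b k * b k)"
    using b2 by (simp add: c1_def d2_def d3_def algebra_simps eval_nat_numeral)
  define A4 where "A4 k = a k * a k * (a k * a k)" for k
  have A1: "vanish 1 (\<lambda>k. A4 k - 1)"
  proof -
    have "vanish 1 (\<lambda>k. pw k * (c1 + c2 * pw k + c3 * pw k ^ 2))"
    proof -
      have 0: "vanish 0 (\<lambda>k. pw k ^ r)" for r by (rule vanish_mono[OF vanish_pw_power]) simp
      have "vanish 0 (\<lambda>k. c1 + c2 * pw k + c3 * pw k ^ 2)"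
        using vanish_mult[OF vanish_const[of c2] 0[of 1]] vanish_mult[OF vanish_const[of c3] 0[of 2]]
        by (intro vanish_add vanish_const) simp_all
      from vanish_mult[OF vanish_pw this] show ?thesis by simp
    qed
    from vanish_add[OF vanish_mono[OF A[unfolded cubic_def], of 1] this] show ?thesis
      by (simp add: A4_def algebra_simps eval_nat_numeral)
  qed
  have A0: "vanish 0 A4"
    using vanish_add[OF vanish_mono[OF A1, of 0] vanish_const[of 1]] by simp
  \<comment> \<open>\<open>e1\<close> and \<open>e2\<close> allow replacing
    \<open>A4 k * P k\<close> by \<open>A4 k - 2 * pw k ^ 2 * S k\<close>: in the N^2 term
    \<open>A4 k\<close> is 1 + O(N), and \<open>S k\<close> supplies one more power of N.\<close>
  have e1: "vanish 4 (\<lambda>k. A4 k * (P k - (1 - 2 * pw k ^ 2 * S k)))"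
    using vanish_mult[OF A0 P] by simp
  have e2: "vanish 4 (\<lambda>k. (A4 k - 1) * (2 * pw k ^ 2 * S k))"
    using vanish_mult[OF A1 pS] by simp
  have "vanish (2 + 2) (\<lambda>k. pw k ^ 2 * ((d2 - c2) + (d3 - c3) * pw k + 2 * S k))"
  proof -
    have "vanish 4 (\<lambda>k. ((A4 k - (1 + c1 * pw k + c2 * pw k ^ 2 + c3 * pw k ^ 3))
        - (b k * b k - (1 + c1 * pw k + d2 * pw k ^ 2 + d3 * pw k ^ 3)))
        + (A4 k * (P k - (1 - 2 * pw k ^ 2 * S k)) - (A4 k - 1) * (2 * pw k ^ 2 * S k)))"
      by (rule vanish_add[OF vanish_diff[OF A[unfolded cubic_def A4_def[symmetric]] B[unfolded cubic_def]]
            vanish_diff[OF e1 e2]])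
    moreover have "((x - (1 + c1 * n + c2 * n ^ 2 + c3 * n ^ 3)) - (x * q - (1 + c1 * n + d2 * n ^ 2 + d3 * n ^ 3)))
        + (x * (q - (1 - 2 * n ^ 2 * s)) - (x - 1) * (2 * n ^ 2 * s))
        = n ^ 2 * ((d2 - c2) + (d3 - c3) * n + 2 * s)" for x q n s
      by (simp add: algebra_simps eval_nat_numeral)
    ultimately show ?thesis unfolding ab A4_def[symmetric] by (simp only: numeral_plus_numeral semiring_norm)
  qed
  then have "vanish 2 (\<lambda>k. (d2 - c2) + (d3 - c3) * pw k + 2 * S k)"
    by (rule vanish_cancel)
  moreover have "(d2 - c2) + (d3 - c3) * n + s
      = (4 * g2 - 2 * g1 ^ 2) - (12 * g3 + 4 * g1 * g2 - 4 * g1 ^ 3) * n + s" for n s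
    by (simp add: d2_def c2_def d3_def c3_def algebra_simps)
  ultimately show ?thesis by (simp only: g1_def g2_def g3_def S_def N_def)
qed

lemma kubota_leopoldt_seq_3_tendsto:
  "kubota_leopoldt_seq p 3 \<longlonglongrightarrow> 6 * dwork_coeff 3 - dwork_coeff 1 ^ 3"
proof -
  define g1 g2 g3 where "g1 = dwork_coeff 1" and "g2 = dwork_coeff 2" and "g3 = dwork_coeff 3"
  define d where "d = 12 * g3 + 4 * g1 * g2 - 4 * g1 ^ 3"
  define S where "S k = inv_sq_sum (p ^ (k + 1))" for k
  have E: "vanish 2 (\<lambda>k. (4 * g2 - 2 * g1 ^ 2) - d * pw k + 2 * S k)"
    unfolding d_def g1_def g2_def g3_def S_def by (rule inv_sq_sum_expansion)
  have S: "vanish 1 S" unfolding S_def by (rule vanish_inv_sq_sum)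
  \<comment> \<open>All but the constant term is O(N), so the constant is 0, which is the relation
    g2 = g1^2/2. Only then can the expansion be divided by N.\<close>
  have "vanish 1 (\<lambda>k. d * pw k - 2 * S k)"
    using vanish_diff[OF vanish_mult[OF vanish_const[of d] vanish_pw] vanish_mult[OF vanish_const[of 2] S]] by simp
  from vanish_add[OF vanish_mono[OF E, of 1] this] have "vanish 1 (\<lambda>k. 4 * g2 - 2 * g1 ^ 2)" by simp
  then have g2: "4 * g2 - 2 * g1 ^ 2 = 0" by (rule vanish_const_zero)
  have "vanish (1 + 1) (\<lambda>k. pw k ^ 1 * (2 * (S k / pw k) - d))"
    using E unfolding g2 one_add_one by (simp add: pw_nonzero algebra_simps)
  then have "vanish 1 (\<lambda>k. 2 * (S k / pw k) - d)" by (rule vanish_cancel)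
  from vanish_mult[OF vanish_const[of "1 / 2"] this]
  have "vanish 1 (\<lambda>k. S k / pw k - d / 2)" by (simp add: algebra_simps)
  then have "(\<lambda>k. S k / pw k) \<longlonglongrightarrow> d / 2" by (rule vanish_tendsto)
  moreover have "d / 2 = 6 * g3 - g1 ^ 3"
  proof -
    have "4 * g1 * g2 = g1 * (4 * g2)" by simp
    also have "4 * g2 = 2 * g1 ^ 2" using g2 by simp
    finally show ?thesis by (simp add: d_def eval_nat_numeral field_simps)
  qed
  ultimately show ?thesis
    by (simp add: kubota_leopoldt_seq_3[abs_def] S_def g1_def g3_def)
qed

end

theorem theorem4p2:
  fixes p :: nat and f :: "'a::{nonarch_field, complete_space} fps" and \<Delta>\<^sub>3 :: 'a
  assumes "prime p" and "odd p"
    and "is_padic_complex p TYPE('a)"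
    and "f = dwork_exp p"
    and "\<Delta>\<^sub>3 = D_inv_x_coeff0 3 f - 1 / fact 3 * D_inv_x_coeff0 1 f ^ 3"
  shows "summable (D_inv_x_terms 3 f) \<and> summable (D_inv_x_terms 1 f) \<and>
    convergent (kubota_leopoldt_seq p 3 :: nat \<Rightarrow> 'a) \<and>
    \<Delta>\<^sub>3 = kubota_leopoldt_L p 3 / 3"
proof -
  interpret padic_absval p "TYPE('a)"
    using assms(1-3) by unfold_locales (simp_all add: is_padic_complex_def)
  have L: "(kubota_leopoldt_seq p 3 :: nat \<Rightarrow> 'a) \<longlonglongrightarrow> 6 * D_inv_x_coeff0 3 f - D_inv_x_coeff0 1 f ^ 3"
    unfolding assms(4) by (rule kubota_leopoldt_seq_3_tendsto)
  \<comment> \<open>The factor 1/2 is 1/(s-1) at s = 3; with the division by 3 it becomes 1/6 =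
    1/3!.\<close>
  then have L3: "kubota_leopoldt_L p 3 = 1 / 2 * (6 * D_inv_x_coeff0 3 f - D_inv_x_coeff0 1 f ^ 3)"
    by (simp add: kubota_leopoldt_L_def limI)
  have "\<Delta>\<^sub>3 = kubota_leopoldt_L p 3 / 3"
    unfolding assms(5) L3 by (simp add: fact_numeral field_simps)
  moreover have "convergent (kubota_leopoldt_seq p 3 :: nat \<Rightarrow> 'a)"
    using L convergentI by blast
  ultimately show ?thesis
    unfolding assms(4) using summable_dwork by blast
qed

end
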